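(* For every cubic graph $G$ that is not isomorphic to the prism $K_2\Box K_3$, we have $A_b(G)\geq 4$. Moreover, $A_b(K_2\Box K_3)=3$.
   Context: All graphs are finite and simple. A graph is cubic if it is 3-regular. $K_2\Box K_3$ denotes the Cartesian product of $K_2$ and $K_3$ (the triangular prism). Write $[k]=\{1,\dots,k\}$. A $k$-coloring of $G$ is a map $c:V(G)\to[k]$ with $c(u)\neq c(v)$ for every edge $uv$; its color classes are $V_i=\{v\in V(G): c(v)=i\}$. An acyclic $k$-coloring is a $k$-coloring such that, for any two colors $i,j$, the subgraph induced by $V_i\cup V_j$ is a forest (contains no cycle). Here a coloring "with $k$ colors" means all $k$ colors are used. Let $c$ be an acyclic coloring of $G$ with color set $[k]$. An acyclic recoloring step is possible for $c$ if there exist a color $i\in[k]$ and a choice of colors $\ell_v\in[k]\setminus\{i\}$, one for each $v\in V_i$, with $\ell_v$ not appearing under $c$ in the closed neighborhood of $v$, such that the map $c_i:V(G)\to[k]\setminus\{i\}$ defined by $c_i(v)=c(v)$ if $c(v)\neq i$ and $c_i(v)=\ell_v$ if $c(v)=i$ is again an acyclic coloring of $G$. The acyclic b-chromatic number $A_b(G)$ is the maximum number $k$ of colors in an acyclic coloring of $G$ for which no acyclic recoloring step is possible. (Equivalently, it is the maximum number of colors in a coloring obtained by starting with the trivial coloring, in which all vertices have distinct colors, and performing acyclic recoloring steps until none is possible.) *)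

theory Defs
  imports "Graph_Theory.Graph_Theory"
begin

text \<open>
  A finite simple graph is a \<^locale>\<open>pair_graph\<close>: a finite, loop-free digraph without parallel
  arcs whose arc set is symmetric, an undirected edge being the pair of its two orientations. The
  library admits the null graph.
\<close>

text \<open>
  In a symmetric digraph \<^const>\<open>pre_digraph.cycle\<close> also holds of the closed walks \<open>a, b, a\<close> along
  a single edge. The cycles of the undirected graph are those of length at least 3.
\<close>
definition forest :: "('a, 'b) pre_digraph \<Rightarrow> bool" where
  "forest G \<longleftrightarrow> (\<nexists>p. pre_digraph.cycle G p \<and> 3 \<le> length p)"

text \<open>As both orientations of each edge are arcs, the out-degree is the undirected degree.\<close>
definition cubic :: "'a pair_pre_digraph \<Rightarrow> bool" where
  "cubic G \<longleftrightarrow> (\<forall>v\<in>pverts G. out_degree (with_proj G) v = 3)"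

definition complete_graph :: "nat \<Rightarrow> nat pair_pre_digraph" where
  "complete_graph n =
     \<lparr>pverts = {1..n}, parcs = {(u, v). u \<in> {1..n} \<and> v \<in> {1..n} \<and> u \<noteq> v}\<rparr>"

definition cartesian_product ::
    "'a pair_pre_digraph \<Rightarrow> 'b pair_pre_digraph \<Rightarrow> ('a \<times> 'b) pair_pre_digraph"
    (infixl \<open>\<box>\<close> 70) where
  "G \<box> H =
     \<lparr>pverts = pverts G \<times> pverts H,
      parcs = {((a, b), (a', b')).
                 (a = a' \<and> a \<in> pverts G \<and> (b, b') \<in> parcs H) \<or>
                 ((a, a') \<in> parcs G \<and> b = b' \<and> b \<in> pverts H)}\<rparr>"

abbreviation prism :: "(nat \<times> nat) pair_pre_digraph" where
  "prism \<equiv> complete_graph 2 \<box> complete_graph 3"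

definition color_class :: "'a pair_pre_digraph \<Rightarrow> ('a \<Rightarrow> nat) \<Rightarrow> nat \<Rightarrow> 'a set" where
  "color_class G c i = {v \<in> pverts G. c v = i}"

definition closed_neighborhood :: "'a pair_pre_digraph \<Rightarrow> 'a \<Rightarrow> 'a set" where
  "closed_neighborhood G v = insert v {u. (v, u) \<in> parcs G}"

text \<open>
  The color set \<open>C\<close> is a parameter, since recoloring steps pass from \<open>{1..k}\<close> to \<open>{1..k} - {i}\<close>.
  Only the values of \<open>c\<close> on the vertices matter, and colors in \<open>C\<close> may remain unused.
\<close>
definition coloring :: "'a pair_pre_digraph \<Rightarrow> nat set \<Rightarrow> ('a \<Rightarrow> nat) \<Rightarrow> bool" where
  "coloring G C c \<longleftrightarrow> c ` pverts G \<subseteq> C \<and> (\<forall>(u, v)\<in>parcs G. c u \<noteq> c v)"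

definition acyclic_coloring :: "'a pair_pre_digraph \<Rightarrow> nat set \<Rightarrow> ('a \<Rightarrow> nat) \<Rightarrow> bool" where
  "acyclic_coloring G C c \<longleftrightarrow>
     coloring G C c \<and>
     (\<forall>i\<in>C. \<forall>j\<in>C. forest (with_proj G \<restriction> (color_class G c i \<union> color_class G c j)))"

definition acyclic_recoloring_possible ::
    "'a pair_pre_digraph \<Rightarrow> nat \<Rightarrow> ('a \<Rightarrow> nat) \<Rightarrow> bool" where
  "acyclic_recoloring_possible G k c \<longleftrightarrow>
     (\<exists>i\<in>{1..k}. \<exists>l.
        (\<forall>v\<in>color_class G c i. l v \<in> {1..k} - {i} \<and> l v \<notin> c ` closed_neighborhood G v) \<and>
        acyclic_coloring G ({1..k} - {i}) (\<lambda>v. if c v = i then l v else c v))"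

definition irreducible_color_numbers :: "'a pair_pre_digraph \<Rightarrow> nat set" where
  "irreducible_color_numbers G =
     {k. \<exists>c. acyclic_coloring G {1..k} c \<and> c ` pverts G = {1..k} \<and>
             \<not> acyclic_recoloring_possible G k c}"

text \<open>
  For a finite graph the maximum exists: the set is bounded by the number of vertices (see below)
  and contains the least number of colors of an acyclic coloring.
\<close>
definition acyclic_b_chromatic_number :: "'a pair_pre_digraph \<Rightarrow> nat" (\<open>A\<^sub>b\<close>) where
  "A\<^sub>b G = Max (irreducible_color_numbers G)"

lemma finite_irreducible_color_numbers:
  assumes "finite (pverts G)"
  shows "finite (irreducible_color_numbers G)"
proof (rule finite_subset)
  show "irreducible_color_numbers G \<subseteq> {..card (pverts G)}"
  proof
    fix k assume "k \<in> irreducible_color_numbers G"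
    then obtain c where "c ` pverts G = {1..k}"
      by (auto simp: irreducible_color_numbers_def)
    with card_image_le[OF assms, of c] show "k \<in> {..card (pverts G)}"
      by simp
  qed
qed simp

lemma complete_digraph_complete_graph: "K\<^bsub>n\<^esub> (with_proj (complete_graph n))"
  unfolding complete_digraph_pair_def by (auto simp: complete_graph_def)

lemma pair_graph_cartesian_product:
  assumes "pair_graph G" "pair_graph H"
  shows "pair_graph (G \<box> H)"
proof -
  interpret G: pair_graph G by fact
  interpret H: pair_graph H by fact
  have sub: "parcs (G \<box> H) \<subseteq> pverts (G \<box> H) \<times> pverts (G \<box> H)"
    by (auto simp: cartesian_product_def dest: G.wellformed' H.wellformed')
  have fin: "finite (pverts (G \<box> H))"
    using G.pair_finite_verts H.pair_finite_verts by (simp add: cartesian_product_def)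
  have sym: "symmetric (with_proj (G \<box> H))"
    unfolding symmetric_def sym_def
    by (auto simp: cartesian_product_def intro: G.arcs_symmetric H.arcs_symmetric)
  have noloop: "fst e \<noteq> snd e" if "e \<in> parcs (G \<box> H)" for e
    using that by (auto simp: cartesian_product_def dest: G.pair_no_loops H.pair_no_loops)
  show ?thesis
    using sub fin sym noloop finite_subset[OF sub]
    by unfold_locales auto
qed

end

(*
  A cubic graph G has an irreducible coloring with 4 colors as soon as it has a "seed": an acyclic
  coloring of a small vertex set S in which every color i has a vertex v that is stuck inside S,
  i.e. each other color either occurs next to v or would close a bicolored cycle through v within S.
  Such a v stays stuck however the rest is colored, and a seed extends to G one vertex at a time:
  if a vertex v cannot be colored, then some neighbor outside S has two differently colored further
  neighbors, so it lies on no bicolored cycle and may be recolored to make room for v.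

  Seeds are found around short cycles. K4, K_{2,3}, diamonds (K4 minus an edge), and triangles that
  are not part of a prism contain one, and so do 4-cycles without triangles. In a component of girth
  at least 5 a vertex and its neighbors can be made to see all colors, except in the Petersen graph,
  which has a seed using its 6-cycles. If only prisms remain, two of them form a seed.
*)
theory Submission
  imports Defs
begin

section \<open>Cycles and cores\<close>

text \<open>A recoloring step has to move every vertex of the discarded class, so one stuck vertex
  per color excludes all steps. Being stuck survives every extension that keeps the colors of the
  seed, and this constraint shapes the proof: the repair of an uncolorable vertex recolors one of
  its neighbors, which must not be a seed vertex. A neighbor is recolored only if its two further
  neighbors block two different colors. A safe vertex, one that the coloring of the seed already
  keeps off every bicolored cycle, blocks nothing. Hence a seed has to give each of its vertices a
  safe neighbor unless the vertex is safe itself.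

  The Petersen graph escapes the coloring of a ball because that coloring pairs up the six vertices
  at distance two, each pair nonadjacent and taken from different branches. There the admissible
  pairs form two triangles, which have no perfect matching.\<close>

definition cyclic_list :: "'a pair_pre_digraph \<Rightarrow> 'a list \<Rightarrow> bool" where
  "cyclic_list G xs \<longleftrightarrow> 3 \<le> length xs \<and> distinct xs \<and>
     successively (\<lambda>u v. (u, v) \<in> parcs G) xs \<and> (last xs, hd xs) \<in> parcs G"

lemma cas_zip:
  assumes "tail H = fst" "head H = snd"
  shows "pre_digraph.cas H x (zip (x # xs) (xs @ [w])) w"
  using assms by (induction xs arbitrary: x) (auto simp: pre_digraph.cas.simps)

lemma zip_arcs_subset:
  assumes "successively (\<lambda>u v. (u, v) \<in> E) (x # xs)" "(last (x # xs), w) \<in> E"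
  shows "set (zip (x # xs) (xs @ [w])) \<subseteq> E"
  using assms by (induction xs arbitrary: x) auto

lemma cyclic_list_not_forest:
  assumes "cyclic_list G xs" "set xs \<subseteq> A"
  shows "\<not> forest (with_proj G \<restriction> A)"
proof -
  let ?H = "with_proj G \<restriction> A"
  from assms(1) obtain x ys where xs: "xs = x # ys"
    by (cases xs) (auto simp: cyclic_list_def)
  \<comment> \<open>Zipping the list with its rotation by one gives the arcs of the closed walk.
    Their heads are \<open>ys @ [x]\<close>, so \<open>distinct xs\<close> is what
    \<open>cycle\<close> demands of the visited vertices after the first.\<close>
  define p where "p = zip (x # ys) (ys @ [x])"
  have len: "length p = length xs"
    by (simp add: p_def xs)
  have H: "tail ?H = fst" "head ?H = snd"
    by (auto simp: induce_subgraph_def)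
  have "set p \<subseteq> parcs G"
    unfolding p_def using assms(1) by (intro zip_arcs_subset) (auto simp: cyclic_list_def xs)
  moreover have "set p \<subseteq> A \<times> A"
    using assms(2) set_zip_leftD[of _ _ "x # ys" "ys @ [x]"] set_zip_rightD[of _ _ "x # ys" "ys @ [x]"]
    unfolding p_def xs by fastforce
  ultimately have "set p \<subseteq> arcs ?H"
    by (auto simp: induce_subgraph_def)
  moreover have "pre_digraph.cas ?H x p x"
    unfolding p_def using H by (rule cas_zip)
  ultimately have w: "pre_digraph.awalk ?H x p x"
    using assms(2) by (auto simp: pre_digraph.awalk_def induce_subgraph_def xs)
  have "tl (pre_digraph.awalk_verts ?H x p) = map snd p"
    using pre_digraph.awalk_verts_conv'[OF \<open>pre_digraph.cas ?H x p x\<close>] H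
    by (auto simp: p_def split: if_splits)
  also have "\<dots> = ys @ [x]"
    by (simp add: p_def)
  finally have "distinct (tl (pre_digraph.awalk_verts ?H x p))"
    using assms(1) by (auto simp: cyclic_list_def xs)
  with w have "pre_digraph.cycle ?H p"
    by (auto simp: pre_digraph.cycle_def p_def)
  moreover have "3 \<le> length p"
    using assms(1) len by (simp add: cyclic_list_def)
  ultimately show ?thesis
    by (auto simp: forest_def)
qed

text \<open>
  A finite graph contains a cycle iff it has a nonempty vertex set inducing minimum degree at
  least 2. Such sets make all acyclicity arguments below local: no paths have to be followed.
\<close>
definition core :: "'a pair_pre_digraph \<Rightarrow> ('a \<Rightarrow> nat) \<Rightarrow> 'a set
  \<Rightarrow> bool" where
  "core G c X \<longleftrightarrow> X \<noteq> {} \<and> (\<exists>i j. c ` X \<subseteq> {i, j}) \<and>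
     (\<forall>x\<in>X. \<exists>y\<in>X. \<exists>z\<in>X. y \<noteq> z \<and> (x, y) \<in> parcs G
       \<and> (x, z) \<in> parcs G)"

definition proper_on ::
  "'a pair_pre_digraph \<Rightarrow> ('a \<Rightarrow> nat) \<Rightarrow> 'a set \<Rightarrow> bool" where
  "proper_on G c U \<longleftrightarrow> (\<forall>u\<in>U. \<forall>v\<in>U. (u, v) \<in> parcs G
  \<longrightarrow> c u \<noteq> c v)"

lemma proper_onD: "\<lbrakk>proper_on G c U; u \<in> U; v \<in> U; (u, v) \<in> parcs G\<rbrakk>
  \<Longrightarrow> c u \<noteq> c v"
  by (auto simp: proper_on_def)

lemma proper_on_subset:
  "\<lbrakk>proper_on G c U; X \<subseteq> U\<rbrakk> \<Longrightarrow> proper_on G c X"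
  by (auto simp: proper_on_def)

text \<open>In a proper core with two colors both neighbors of \<open>x\<close> carry the color
  other than \<open>c x\<close>.\<close>

lemma coreE:
  assumes "core G c X" "proper_on G c X" "x \<in> X"
  obtains y z where "y \<in> X" "z \<in> X" "y \<noteq> z" "(x, y) \<in> parcs G"
    "(x, z) \<in> parcs G" "c y = c z"
proof -
  from assms obtain i j y z where "c ` X \<subseteq> {i, j}" "y \<in> X" "z \<in> X" "y \<noteq> z"
      "(x, y) \<in> parcs G" "(x, z) \<in> parcs G"
    unfolding core_def by meson
  moreover have "c y \<noteq> c x" "c z \<noteq> c x"
    using assms calculation by (metis proper_onD)+
  ultimately show ?thesis
    using that assms(3) by (smt (verit) image_subset_iff insertE singletonD)
qed

text \<open>At most one of the two core neighbors of \<open>y\<close> is \<open>x\<close>, and the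
  other one has the only color besides \<open>c y\<close>. This allows a core to be followed without
  turning back.\<close>

lemma core_next:
  assumes "core G c X" "proper_on G c X" "x \<in> X" "y \<in> X" "(x, y) \<in> parcs G"
  obtains w where "w \<in> X" "w \<noteq> x" "(y, w) \<in> parcs G" "c w = c x"
proof -
  from assms obtain i j where ij: "c ` X \<subseteq> {i, j}"
    unfolding core_def by meson
  obtain a b where ab: "a \<in> X" "b \<in> X" "a \<noteq> b" "(y, a) \<in> parcs G" "(y, b) \<in> parcs G"
    using assms(1,4) unfolding core_def by meson
  define w where "w = (if a = x then b else a)"
  have w: "w \<in> X" "w \<noteq> x" "(y, w) \<in> parcs G"
    using ab by (auto simp: w_def)
  moreover have "c w \<noteq> c y" "c x \<noteq> c y"
    using assms w by (metis proper_onD)+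
  then have "c w = c x"
    using ij w(1) assms(3,4) by (smt (verit) image_subset_iff insertE singletonD)
  ultimately show ?thesis
    using that by blast
qed

text \<open>The alternating path \<open>x' y x z x''\<close> is what is refuted for seeds and for
  the prism. Its ends coincide if the core is a 4-cycle.\<close>

lemma core_path:
  assumes "core G c X" "proper_on G c X"
  obtains x y z x' x'' where "x \<in> X" "y \<in> X" "z \<in> X" "x' \<in> X" "x'' \<in> X"
    "(x, y) \<in> parcs G" "(x, z) \<in> parcs G" "y \<noteq> z" "c y = c z"
    "(y, x') \<in> parcs G" "x' \<noteq> x" "c x' = c x" "(z, x'') \<in> parcs G" "x'' \<noteq> x"
    "c x'' = c x" "c y \<noteq> c x"
proof -
  obtain x where x: "x \<in> X"
    using assms(1) by (auto simp: core_def)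
  obtain y z where yz: "y \<in> X" "z \<in> X" "y \<noteq> z" "(x, y) \<in> parcs G"
    "(x, z) \<in> parcs G" "c y = c z"
    using coreE[OF assms x] .
  obtain x' where "x' \<in> X" "x' \<noteq> x" "(y, x') \<in> parcs G" "c x' = c x"
    using core_next[OF assms x yz(1,4)] .
  moreover obtain x'' where "x'' \<in> X" "x'' \<noteq> x" "(z, x'') \<in> parcs G" "c x'' = c x"
    using core_next[OF assms x yz(2,5)] .
  moreover have "c y \<noteq> c x"
    using proper_onD[OF assms(2) x yz(1,4)] by simp
  ultimately show ?thesis
    using that x yz by blast
qed

lemma cas_nth:
  assumes "pre_digraph.cas H u p v" "tail H = fst" "head H = snd" "p \<noteq> []"
  shows "fst (p ! 0) = u" "snd (last p) = v"
    "\<And>i. Suc i < length p \<Longrightarrow> snd (p ! i) = fst (p ! Suc i)"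
proof -
  have "fst (p ! 0) = u \<and> snd (last p) = v \<and>
      (\<forall>i. Suc i < length p \<longrightarrow> snd (p ! i) = fst (p ! Suc i))"
    using assms
  proof (induction p arbitrary: u)
    case (Cons e p)
    then have e: "fst e = u" "pre_digraph.cas H (snd e) p v"
      by (auto simp: pre_digraph.cas.simps)
    show ?case
    proof (cases "p = []")
      case True
      then show ?thesis using e by (auto simp: pre_digraph.cas.simps)
    next
      case False
      then show ?thesis
        using Cons.IH[OF e(2)] Cons.prems e(1) by (auto simp: nth_Cons split: nat.splits)
    qed
  qed simp
  then show "fst (p ! 0) = u" "snd (last p) = v"
    "\<And>i. Suc i < length p \<Longrightarrow> snd (p ! i) = fst (p ! Suc i)"
    by auto
qed

text \<open>The vertices of a cycle form a core: predecessor and successor of a vertex differ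
  because the length is at least 3.\<close>

lemma not_forest_core:
  assumes "\<not> forest (with_proj G \<restriction> A)" and sym: "sym (parcs G)" and
    "\<exists>i j. c ` A \<subseteq> {i, j}"
  obtains X where "X \<subseteq> A" "core G c X"
proof -
  let ?H = "with_proj G \<restriction> A"
  obtain p u where p: "pre_digraph.awalk ?H u p u" "distinct (tl (pre_digraph.awalk_verts ?H u p))"
      "p \<noteq> []" "3 \<le> length p"
    using assms(1) by (auto simp: forest_def pre_digraph.cycle_def)
  have H: "tail ?H = fst" "head ?H = snd"
    by (auto simp: induce_subgraph_def)
  have cas: "pre_digraph.cas ?H u p u" and arcs: "set p \<subseteq> arcs ?H"
    using p(1) by (auto simp: pre_digraph.awalk_def)
  note nth = cas_nth[OF cas H p(3)]
  have "distinct (map snd p)"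
    using p(2,3) pre_digraph.awalk_verts_conv'[OF cas] H by simp
  then have inj: "snd (p ! i) \<noteq> snd (p ! j)" if "i < length p" "j < length p" "i \<noteq> j" for i j
    using that by (auto simp: distinct_conv_nth)
  define X where "X = set (map snd p)"
  have arc: "p ! i \<in> parcs G" "snd (p ! i) \<in> X" "snd (p ! i) \<in> A" if "i < length p" for i
    using subsetD[OF arcs nth_mem[OF that]] nth_mem[OF that] by (auto simp: X_def induce_subgraph_def)
  have sub: "X \<subseteq> A"
  proof
    fix x assume "x \<in> X"
    then obtain i where "i < length p" "x = snd (p ! i)"
      unfolding X_def by (metis in_set_conv_nth length_map nth_map)
    then show "x \<in> A" using arc(3) by simp
  qed
  have prev: "(snd (p ! i), snd (p ! (if i = 0 then length p - 1 else i - 1))) \<in> parcs G"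
    if "i < length p" for i
  proof -
    have "snd (p ! (if i = 0 then length p - 1 else i - 1)) = fst (p ! i)"
      using nth that p(3) by (cases i) (auto simp: last_conv_nth)
    then show ?thesis
      using arc(1)[OF that] sym by (metis prod.collapse symD)
  qed
  have "\<exists>y\<in>X. \<exists>z\<in>X. y \<noteq> z \<and> (x, y) \<in> parcs G \<and> (x, z)
    \<in> parcs G" if "x \<in> X" for x
  proof -
    from that obtain i where i: "i < length p" "x = snd (p ! i)"
      by (auto simp: X_def in_set_conv_nth)
    \<comment> \<open>Vertices are indexed as heads of arcs, so \<open>k\<close> and
      \<open>j\<close> are the cyclic predecessor and successor of position
      \<open>i\<close>.\<close>
    define k where "k = (if i = 0 then length p - 1 else i - 1)"
    define j where "j = (if Suc i = length p then 0 else Suc i)"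
    have jk: "j < length p" "k < length p" "j \<noteq> k"
      using i(1) p(4) by (auto simp: j_def k_def)
    have "fst (p ! j) = x"
    proof (cases "Suc i = length p")
      case True
      then have "last p = p ! i"
        using p(3) by (simp add: last_conv_nth flip: True)
      then show ?thesis
        using nth(1,2) i(2) True by (simp add: j_def)
    next
      case False
      then have "Suc i < length p" using i(1) by simp
      then show ?thesis
        using nth(3) i(2) by (simp add: j_def)
    qed
    then have "(x, snd (p ! j)) \<in> parcs G"
      using arc(1)[OF jk(1)] by (cases "p ! j") simp
    moreover have "(x, snd (p ! k)) \<in> parcs G"
      using prev[OF i(1)] i(2) by (simp add: k_def)
    moreover have "snd (p ! j) \<in> X" "snd (p ! k) \<in> X" "snd (p ! j) \<noteq> snd (p ! k)"
      using arc(2) inj jk by auto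
    ultimately show ?thesis
      by blast
  qed
  moreover have "X \<noteq> {}"
    using p(3) by (simp add: X_def)
  moreover obtain i j where "c ` A \<subseteq> {i, j}"
    using assms(3) by metis
  then have "c ` X \<subseteq> {i, j}"
    using sub by (meson image_mono subset_trans)
  ultimately have "core G c X"
    unfolding core_def by metis
  with that sub show ?thesis .
qed

lemma acyclic_coloringI:
  assumes "pair_graph G" "c ` pverts G \<subseteq> C" "proper_on G c (pverts G)"
    and "\<And>X. X \<subseteq> pverts G \<Longrightarrow> \<not> core G c X"
  shows "acyclic_coloring G C c"
proof -
  interpret pair_graph G by fact
  have sym: "sym (parcs G)"
    using pair_sym_arcs by (simp add: symmetric_def)
  have "forest (with_proj G \<restriction> (color_class G c i \<union> color_class G c j))" for i j
  proof (rule ccontr)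
    assume nf: "\<not> forest (with_proj G \<restriction> (color_class G c i \<union> color_class G c j))"
    have "\<exists>i' j'. c ` (color_class G c i \<union> color_class G c j) \<subseteq> {i', j'}"
      by (intro exI[of _ i] exI[of _ j]) (auto simp: color_class_def)
    then obtain X where "X \<subseteq> color_class G c i \<union> color_class G c j" "core G c X"
      using not_forest_core[OF nf sym] by blast
    moreover from this have "X \<subseteq> pverts G"
      by (auto simp: color_class_def)
    ultimately show False
      using assms(4) by blast
  qed
  then show ?thesis
    using assms(2,3) wellformed'
    by (auto simp: acyclic_coloring_def coloring_def proper_on_def)
qed

lemma acyclic_coloring_cyclic_list:
  assumes "acyclic_coloring G C c" "cyclic_list G xs" "set xs \<subseteq> pverts G"
    "c ` set xs \<subseteq> {i, j}" "i \<in> C" "j \<in> C"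
  shows False
proof -
  have "set xs \<subseteq> color_class G c i \<union> color_class G c j"
    using assms(3,4) by (auto simp: color_class_def)
  from cyclic_list_not_forest[OF assms(2) this] show False
    using assms(1,5,6) by (auto simp: acyclic_coloring_def)
qed

section \<open>Extending partial colorings\<close>

locale cubic_graph = pair_graph G for G :: "'a pair_pre_digraph" +
  assumes cubic: "cubic G"
begin

abbreviation V :: "'a set" where "V \<equiv> pverts G"

abbreviation adj :: "'a \<Rightarrow> 'a \<Rightarrow> bool" where "adj u v \<equiv> (u, v) \<in> parcs G"

definition nbrs :: "'a \<Rightarrow> 'a set" where "nbrs v = {u. adj v u}"

lemma adj_sym: "adj u v \<Longrightarrow> adj v u"
  using pair_sym_arcs by (auto simp: symmetric_def dest: symD)

lemma adj_commute: "adj u v \<longleftrightarrow> adj v u"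
  using adj_sym by blast

lemma not_adj_self [simp]: "\<not> adj v v"
  using pair_no_loops by force

lemma adj_in_V: "adj u v \<Longrightarrow> u \<in> V" "adj u v \<Longrightarrow> v \<in> V"
  using wellformed' by auto

lemma nbrs_subset: "nbrs v \<subseteq> V"
  by (auto simp: nbrs_def adj_in_V)

lemma finite_nbrs [simp]: "finite (nbrs v)"
  using nbrs_subset pair_finite_verts finite_subset by blast

lemma card_nbrs: "v \<in> V \<Longrightarrow> card (nbrs v) = 3"
proof -
  assume "v \<in> V"
  have "out_arcs (with_proj G) v = Pair v ` nbrs v"
    by (auto simp: out_arcs_def nbrs_def)
  then have "card (nbrs v) = out_degree (with_proj G) v"
    by (simp add: out_degree_def card_image inj_on_def)
  then show ?thesis
    using cubic \<open>v \<in> V\<close> by (simp add: cubic_def)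
qed

text \<open>
  A safe vertex lies in no core of any proper coloring agreeing with \<open>c\<close> on
    \<open>S\<close>: peel off vertices
  no two of whose remaining neighbors share a color.
\<close>
inductive safe :: "'a set \<Rightarrow> ('a \<Rightarrow> nat) \<Rightarrow> 'a \<Rightarrow> bool" for
  S c where
  safeI: "\<lbrakk>nbrs t \<subseteq> S;
    \<And>y z. \<lbrakk>y \<in> nbrs t; z \<in> nbrs t; y \<noteq> z; c y = c z\<rbrakk>
      \<Longrightarrow> safe S c y \<or> safe S c z\<rbrakk> \<Longrightarrow> safe S c t"

lemma safe_not_core:
  assumes "safe S c0 t" "\<And>s. s \<in> S \<Longrightarrow> c s = c0 s" "core G c X" "proper_on G c X"
  shows "t \<notin> X"
  using assms(1)
proof induction
  case (safeI t)
  show ?case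
  proof
    assume "t \<in> X"
    then obtain y z where yz: "y \<in> X" "z \<in> X" "y \<noteq> z" "adj t y" "adj t z" "c y = c z"
      using coreE[OF assms(3,4)] by blast
    then have "y \<in> nbrs t" "z \<in> nbrs t" "c0 y = c0 z"
      using safeI(1) assms(2) by (auto simp: nbrs_def) (metis mem_Collect_eq nbrs_def subsetD)
    then show False
      using safeI(2) yz by blast
  qed
qed

lemma safe_nbrs: "safe S c t \<Longrightarrow> nbrs t \<subseteq> S"
  by (cases rule: safe.cases) auto

definition partial_coloring :: "('a \<Rightarrow> nat) \<Rightarrow> 'a set \<Rightarrow> bool" where
  "partial_coloring c U \<longleftrightarrow> U \<subseteq> V \<and> c ` U \<subseteq> {1..4} \<and>
  proper_on G c U \<and> (\<forall>X\<subseteq>U. \<not> core G c X)"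

lemma core_cong: "(\<And>x. x \<in> X \<Longrightarrow> c x = c' x) \<Longrightarrow> core G c X
  \<longleftrightarrow> core G c' X"
  unfolding core_def by (simp add: image_def cong: bex_cong)

end

text \<open>The guard keeps the seed untouched: a seed vertex with a neighbor outside has a safe
  neighbor, so it has at most one far color and is never chosen for recoloring.\<close>

locale guarded_coloring = cubic_graph +
  fixes S :: "'a set" and c0 :: "'a \<Rightarrow> nat"
  assumes guard: "\<And>s v. \<lbrakk>s \<in> S; adj s v; v \<notin> S\<rbrakk> \<Longrightarrow>
    \<exists>t. adj s t \<and> t \<in> S \<and> safe S c0 t"
begin

definition extends :: "('a \<Rightarrow> nat) \<Rightarrow> 'a set \<Rightarrow> bool" where
  "extends c U \<longleftrightarrow> partial_coloring c U \<and> S \<subseteq> U \<and>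
  (\<forall>s\<in>S. c s = c0 s)"

lemma not_safe_core: "\<lbrakk>extends c U; \<And>u. u \<in> S \<Longrightarrow> c' u = c u; core G c'
  X; proper_on G c' X; t \<in> X\<rbrakk> \<Longrightarrow> \<not> safe S c0 t"
  using safe_not_core[of S c0 t c' X] by (auto simp: extends_def)

text \<open>
  The colors that may block \<open>v\<close> because of its neighbor \<open>u\<close>: a core through
    \<open>u\<close> and \<open>v\<close> contains
  a further neighbor of \<open>u\<close> in the color of \<open>v\<close>.
\<close>
definition far :: "('a \<Rightarrow> nat) \<Rightarrow> 'a set \<Rightarrow> 'a \<Rightarrow> 'a
  \<Rightarrow> nat set" where
  "far c U v u = c ` {w \<in> nbrs u \<inter> U. w \<noteq> v \<and> \<not> safe S c0 w}"

lemma far_card_le: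
  assumes "adj v u"
  shows "finite (far c U v u)" "card (far c U v u) \<le> 2"
proof -
  let ?W = "{w \<in> nbrs u \<inter> U. w \<noteq> v \<and> \<not> safe S c0 w}"
  have W: "?W \<subseteq> nbrs u - {v}" by auto
  have "card (nbrs u - {v}) = 2"
    using card_nbrs[of u] assms adj_sym by (auto simp: nbrs_def adj_in_V)
  then have "card ?W \<le> 2"
    using card_mono[OF _ W] by simp
  moreover have "finite ?W"
    using W finite_subset[of ?W "nbrs u - {v}"] by simp
  ultimately show "finite (far c U v u)" "card (far c U v u) \<le> 2"
    using card_image_le[of ?W c] by (auto simp: far_def)
qed

text \<open>Two far colors use up both neighbors of \<open>u\<close> other than \<open>v\<close>:
  they are colored, unsafe and of different colors. For \<open>u\<close> in \<open>S\<close>, one of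
  them would be the safe neighbor provided by \<open>guard\<close>.\<close>

lemma far_full:
  assumes "adj v u" "card (far c U v u) = 2" "S \<subseteq> U" "v \<notin> U"
  shows "nbrs u - {v} \<subseteq> U" "far c U v u = c ` (nbrs u - {v})" "inj_on c (nbrs u - {v})"
    "u \<notin> S"
proof -
  let ?W = "{w \<in> nbrs u \<inter> U. w \<noteq> v \<and> \<not> safe S c0 w}"
  have W: "?W \<subseteq> nbrs u - {v}" by auto
  have 2: "card (nbrs u - {v}) = 2"
    using card_nbrs[of u] assms adj_sym by (auto simp: nbrs_def adj_in_V)
  have fin: "finite ?W"
    using W finite_subset[of ?W "nbrs u - {v}"] by simp
  have "2 \<le> card ?W"
    using assms(2) card_image_le[OF fin, of c] by (simp add: far_def)
  then have eq: "?W = nbrs u - {v}"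
    using W 2 card_mono[OF _ W] by (intro card_subset_eq) simp_all
  then show "nbrs u - {v} \<subseteq> U" "far c U v u = c ` (nbrs u - {v})"
    by (auto simp: far_def)
  then show "inj_on c (nbrs u - {v})"
    using assms(2) 2 by (intro eq_card_imp_inj_on) auto
  show "u \<notin> S"
  proof
    assume "u \<in> S"
    moreover have "v \<notin> S" using assms by blast
    ultimately obtain t where t: "adj u t" "t \<in> S" "safe S c0 t"
      using guard assms(1) adj_sym by blast
    then have "t \<in> ?W"
      using eq \<open>v \<notin> S\<close> by (auto simp: nbrs_def)
    then show False using t by simp
  qed
qed

text \<open>A core created by coloring \<open>v\<close> passes through \<open>v\<close> and two
  equally colored neighbors of it. It leaves each of them by another vertex of color
  \<open>x\<close>, which is unsafe because it lies in a core.\<close>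

lemma extend_or_blocked:
  assumes "extends c U" "v \<in> V" "v \<notin> U" "x \<in> {1..4}" "x \<notin> c ` (nbrs v \<inter> U)"
    "\<not> extends (c(v := x)) (insert v U)"
  obtains y z where "y \<in> nbrs v \<inter> U" "z \<in> nbrs v \<inter> U" "y \<noteq> z" "c y = c z"
    "x \<in> far c U v y" "x \<in> far c U v z"
proof -
  let ?c = "c(v := x)"
  have c: "U \<subseteq> V" "c ` U \<subseteq> {1..4}" "proper_on G c U"
    "\<And>X. X \<subseteq> U \<Longrightarrow> \<not> core G c X" "S \<subseteq> U"
    "\<And>s. s \<in> S \<Longrightarrow> c s = c0 s"
    using assms(1) by (auto simp: extends_def partial_coloring_def)
  have proper: "proper_on G ?c (insert v U)"
    using c(3) assms(5) by (auto simp: proper_on_def nbrs_def adj_commute)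
  have "\<exists>X\<subseteq>insert v U. core G ?c X"
  proof (rule ccontr)
    assume "\<not> ?thesis"
    then have "extends ?c (insert v U)"
      using c proper assms(2-4) by (auto simp: extends_def partial_coloring_def)
    with assms(6) show False by blast
  qed
  then obtain X where X: "X \<subseteq> insert v U" "core G ?c X" by blast
  have pX: "proper_on G ?c X"
    using proper X(1) by (rule proper_on_subset)
  have "v \<in> X"
  proof (rule ccontr)
    assume "v \<notin> X"
    then have "X \<subseteq> U" using X(1) by auto
    moreover have "core G c X"
      using \<open>v \<notin> X\<close> by (intro iffD1[OF core_cong X(2)]) auto
    ultimately show False using c(4) by blast
  qed
  have ns: "\<not> safe S c0 w" if "w \<in> X" for w
  proof (rule not_safe_core[OF assms(1) _ X(2) pX that])
    show "?c u = c u" if "u \<in> S" for u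
      using that assms(3) c(5) by auto
  qed
  from coreE[OF X(2) pX \<open>v \<in> X\<close>] obtain y z where
    yz: "y \<in> X" "z \<in> X" "y \<noteq> z" "adj v y" "adj v z" "?c y = ?c z" .
  have "y \<noteq> v" "z \<noteq> v" using yz by auto
  have far: "x \<in> far c U v y" if y: "y \<in> X" "adj v y" for y
  proof -
    obtain w where "w \<in> X" "w \<noteq> v" "adj y w" "?c w = ?c v"
      using core_next[OF X(2) pX \<open>v \<in> X\<close> y] .
    then show ?thesis
      using ns X(1) by (auto simp: far_def nbrs_def intro!: image_eqI[of _ _ w])
  qed
  show ?thesis
    using that[of y z] yz X(1) far \<open>y \<noteq> v\<close> \<open>z \<noteq> v\<close>
      by (auto simp: nbrs_def)
qed

text \<open>
  With two far colors, \<open>u\<close> has differently colored neighbors besides the uncolored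
    \<open>v\<close>, so it lies on
  no bicolored cycle whatever its color.
\<close>
lemma recolor:
  assumes "extends c U" "v \<notin> U" "u \<in> nbrs v \<inter> U" "card (far c U v u) = 2"
    "e \<in> {1..4}" "e \<notin> far c U v u"
  shows "extends (c(u := e)) U"
proof -
  let ?c = "c(u := e)"
  have c: "U \<subseteq> V" "c ` U \<subseteq> {1..4}" "proper_on G c U"
    "\<And>X. X \<subseteq> U \<Longrightarrow> \<not> core G c X" "S \<subseteq> U"
    "\<And>s. s \<in> S \<Longrightarrow> c s = c0 s"
    using assms(1) by (auto simp: extends_def partial_coloring_def)
  have vu: "adj v u" "u \<in> U" using assms(3) by (auto simp: nbrs_def)
  note full = far_full[OF vu(1) assms(4) c(5) assms(2)]
  have e: "c w \<noteq> e" if "adj u w" "w \<in> U" for w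
    using that assms(2,6) full(2) by (auto simp: nbrs_def)
  have proper: "proper_on G ?c U"
    using c(3) e by (auto simp: proper_on_def adj_commute)
  have "\<not> core G ?c X" if X: "X \<subseteq> U" for X
  proof
    assume core: "core G ?c X"
    show False
    proof (cases "u \<in> X")
      case True
      from coreE[OF core proper_on_subset[OF proper X] True] obtain y z where
        yz: "y \<in> X" "z \<in> X" "y \<noteq> z" "adj u y" "adj u z" "?c y = ?c z" .
      moreover have "y \<noteq> u" "z \<noteq> u" "y \<noteq> v" "z \<noteq> v"
        using yz X assms(2) by auto
      ultimately show False
        using inj_onD[OF full(3), of y z] by (auto simp: nbrs_def)
    next
      case False
      then have "core G c X"
        by (intro iffD1[OF core_cong core]) auto
      with c(4) X show False by blast
    qed
  qed
  then show ?thesis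
    using c proper assms(5) full(4) by (auto simp: extends_def partial_coloring_def)
qed

lemma far_upd_nonadj: "\<not> adj w u \<Longrightarrow> far (c(u := e)) U v w = far c U v w"
  by (auto simp: far_def nbrs_def)

text \<open>Equally colored vertices are nonadjacent, so recoloring one of them leaves the far
  colors of the other alone. This carries far sets through successive recolorings.\<close>

lemma far_upd_same:
  assumes "extends c U" "u \<in> U" "w \<in> U" "c u = c w"
  shows "far (c(u := e)) U v w = far c U v w"
  using assms proper_onD[of G c U w u]
    by (intro far_upd_nonadj) (auto simp: extends_def partial_coloring_def)


text \<open>Failure means that every color absent from the neighbors of \<open>v\<close> is far at
  two equally colored neighbors, while a far set has at most two elements. Either this is already
  impossible by counting, or far sets are full and allow recoloring neighbors until some color
  becomes available.\<close>

lemma extend_vertex: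
  assumes "extends c U" "v \<in> V" "v \<notin> U"
  shows "\<exists>c'. extends c' (insert v U)"
proof (rule ccontr)
  assume contra: "\<not> ?thesis"
  define D where "D = nbrs v \<inter> U"
  have blocked: "\<exists>y z. y \<in> D \<and> z \<in> D \<and> y \<noteq> z \<and> c' y = c' z \<and>
    x \<in> far c' U v y \<and> x \<in> far c' U v z"
    if "extends c' U" "x \<in> {1..4}" "x \<notin> c' ` D" for c' x
    using extend_or_blocked[OF that(1) assms(2,3) that(2)] that(3) contra unfolding D_def by metis
  have adj: "adj v u" "u \<in> U" if "u \<in> D" for u
    using that by (auto simp: D_def nbrs_def)
  have far_le: "finite (far c' U v u)" "card (far c' U v u) \<le> 2" if "u \<in> D" for u c'
    using far_card_le[OF adj(1)[OF that]] by auto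
  have finD: "finite D" and "card D \<le> 3"
    using card_nbrs[OF assms(2)] card_mono[of "nbrs v" D] by (auto simp: D_def)
  have range: "c u \<in> {1..4}" if "u \<in> D" for u
    using assms(1) adj(2)[OF that] by (auto simp: extends_def partial_coloring_def)
  have recolor': "extends (c'(u := e)) U"
    if "extends c' U" "u \<in> D" "card (far c' U v u) = 2" "e \<in> {1..4}"
      "e \<notin> far c' U v u" for c' u e
    using recolor[OF that(1) assms(3) _ that(3-5)] that(2) by (simp add: D_def)
  have far_same: "far (c'(u := e)) U v w = far c' U v w"
    if "extends c' U" "u \<in> D" "w \<in> D" "c' u = c' w" for c' u w e
    using far_upd_same[OF that(1) adj(2)[OF that(2)] adj(2)[OF that(3)] that(4)] .
  have "\<not> inj_on c D"
  proof
    assume inj: "inj_on c D"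
    have "card (c ` D) \<le> 3"
      using card_image_le[OF finD, of c] \<open>card D \<le> 3\<close> by linarith
    then have "\<not> {1..4} \<subseteq> c ` D"
      using card_mono[of "c ` D" "{1..4}"] finD by auto
    then show False
      using blocked[OF assms(1)] inj by (meson inj_onD subsetI)
  qed
  then obtain y z where yz: "y \<in> D" "z \<in> D" "y \<noteq> z" "c y = c z"
    by (auto simp: inj_on_def)
  have "\<exists>w. D \<subseteq> {y, z, w}"
  proof -
    have "card (D - {y, z}) \<le> Suc 0"
      using card_Diff_subset[of "{y, z}" D] yz(1-3) \<open>card D \<le> 3\<close> by auto
    then have eq: "\<forall>a\<in>D - {y, z}. \<forall>b\<in>D - {y, z}. a = b"
      by (rule iffD1[OF card_le_Suc0_iff_eq[OF finite_Diff[OF finD]]])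
    show ?thesis
    proof (cases "D \<subseteq> {y, z}")
      case False
      then obtain w where "w \<in> D - {y, z}" by blast
      then have "D \<subseteq> {y, z, w}" using eq by blast
      then show ?thesis ..
    qed auto
  qed
  show False
  proof (cases "D = {y, z}")
    case True
    \<comment> \<open>Three colors are absent from the neighbors, and all of them would have to be
      far at \<open>y\<close>.\<close>
    have "{1..4} - {c y} \<subseteq> far c U v y"
    proof
      fix x assume "x \<in> {1..4} - {c y}"
      then obtain y' z' where "y' \<in> D" "z' \<in> D" "y' \<noteq> z'" "x \<in> far c U v y'"
        "x \<in> far c U v z'"
        using blocked[OF assms(1), of x] True yz(4) by auto
      then show "x \<in> far c U v y"
        using True by auto
    qed
    then have "card ({1..4} - {c y}) \<le> 2"
      using far_le[OF yz(1), of c] card_mono[of "far c U v y"] le_trans by blast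
    then show False
      using range[OF yz(1)] by simp
  next
    case False
    obtain w where "D \<subseteq> {y, z, w}"
      using \<open>\<exists>w. D \<subseteq> {y, z, w}\<close> by blast
    moreover from this have "w \<in> D"
      using False yz(1,2) by (cases "w \<in> D") (auto)
    ultimately have w: "D = {y, z, w}" "w \<noteq> y" "w \<noteq> z"
      using False yz(1,2) by auto
    show False
    proof (cases "c w = c y")
      case False
      \<comment> \<open>\<open>A\<close> consists of the two absent colors. Only \<open>y\<close>
        and \<open>z\<close> agree, so their far sets equal \<open>A\<close>, and \<open>y\<close>
        may take the color of \<open>w\<close>. Now \<open>y\<close> and \<open>w\<close> are the
        only agreeing pair, so the far set of \<open>w\<close> is \<open>A\<close> too. Hence in the
        original coloring \<open>w\<close> may take the color of \<open>y\<close>; then all three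
        agree, and the old color of \<open>w\<close> is neither on a neighbor nor far.\<close>
      define A where "A = {1..4} - {c y, c w}"
      have cardA: "card A = 2"
        using range[OF yz(1)] range[OF \<open>w \<in> D\<close>] False by (simp add: A_def card_Diff_subset)
      have far_eq: "far c' U v u = A" if "A \<subseteq> far c' U v u" "u \<in> D" for c' u
        using far_le[OF that(2)] that(1) cardA by (metis card_seteq)
      have only: "A \<subseteq> far c' U v u \<and> A \<subseteq> far c' U v u'"
        if "extends c' U" "c' ` D = {c y, c w}"
          and pair: "\<And>p q. p \<in> D \<Longrightarrow> q \<in> D \<Longrightarrow> p \<noteq> q
            \<Longrightarrow> c' p = c' q \<Longrightarrow> {p, q} = {u, u'}" for c' u u'
      proof -
        have "x \<in> far c' U v u \<and> x \<in> far c' U v u'" if "x \<in> A" for x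
        proof -
          have "x \<in> {1..4}" "x \<notin> c' ` D"
            using \<open>x \<in> A\<close> \<open>c' ` D = _\<close> by (auto simp: A_def)
          from blocked[OF \<open>extends c' U\<close> this] obtain p q where
            pq: "p \<in> D" "q \<in> D" "p \<noteq> q" "c' p = c' q" "x \<in> far c' U v p"
              "x \<in> far c' U v q"
            by blast
          from pair[OF pq(1-4)] pq(5,6) show ?thesis
            by (auto simp: doubleton_eq_iff)
        qed
        then show ?thesis by blast
      qed
      have "A \<subseteq> far c U v y \<and> A \<subseteq> far c U v z"
        by (rule only[OF assms(1)]) (use w yz False in auto)
      then have fy: "far c U v y = A" and fz: "far c U v z = A"
        using far_eq yz by auto
      define c1 where "c1 = c(y := c w)"
      have c1: "extends c1 U"
        unfolding c1_def using range[OF \<open>w \<in> D\<close>] fy cardA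
        by (intro recolor'[OF assms(1) yz(1)]) (auto simp: A_def)
      have "A \<subseteq> far c1 U v y \<and> A \<subseteq> far c1 U v w"
        by (rule only[OF c1]) (use w yz False in \<open>auto simp: c1_def\<close>)
      then have "far c1 U v w = A"
        using far_eq w by auto
      moreover have "far (c1(y := c y)) U v w = far c1 U v w"
        using w yz by (intro far_same[OF c1]) (auto simp: c1_def)
      ultimately have fw: "far c U v w = A"
        by (simp add: c1_def)
      define c2 where "c2 = c(w := c y)"
      have c2: "extends c2 U"
        unfolding c2_def using range[OF yz(1)] fw cardA
        by (intro recolor'[OF assms(1) \<open>w \<in> D\<close>]) (auto simp: A_def)
      have c_eq: "c = c2(w := c w)"
        by (simp add: c2_def)
      have "far c2 U v u = A" if "u \<in> D" for u
      proof -
        have "far (c2(w := c w)) U v u = far c2 U v u"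
          using that w yz by (intro far_same[OF c2]) (auto simp: c2_def)
        then show ?thesis
          using that w fy fz fw c_eq by auto
      qed
      moreover have "c w \<notin> c2 ` D"
        using w yz False by (auto simp: c2_def)
      ultimately show False
        using blocked[OF c2, of "c w"] range[OF \<open>w \<in> D\<close>] by (auto simp: A_def)
    next
      case True
      \<comment> \<open>All three neighbors agree. Each of the three absent colors is far at two of
        them, yet each far set omits one, so the far sets are \<open>{f, g}\<close>,
        \<open>{e, g}\<close>, \<open>{e, f}\<close>. Recoloring \<open>y\<close> with
        \<open>e\<close> leaves \<open>z\<close> and \<open>w\<close> as the only agreeing pair, and
        \<open>f\<close> is not far at \<open>z\<close>.\<close>
      define A where "A = {1..4} - {c y}"
      have cardA: "card A = 3"
        using range[OF yz(1)] by (simp add: A_def)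
      have two: "x \<in> far c U v p \<or> x \<in> far c U v q"
        if "x \<in> A" "D = {p, q, r}" for x p q r
      proof -
        have "x \<in> {1..4}" "x \<notin> c ` D"
          using that(1) w(1) yz(4) True by (auto simp: A_def)
        from blocked[OF assms(1) this] obtain u u' where
          "u \<in> D" "u' \<in> D" "u \<noteq> u'" "x \<in> far c U v u" "x \<in> far c U v u'"
          by blast
        then show ?thesis
          unfolding that(2) by blast
      qed
      have miss: "\<exists>e\<in>A. e \<notin> far c U v u" if "u \<in> D" for u
      proof (rule ccontr)
        assume "\<not> ?thesis"
        then have "A \<subseteq> far c U v u" by blast
        from card_mono[OF far_le(1)[OF that] this] show False
          using far_le(2)[OF that, of c] cardA by simp
      qed
      obtain e where e: "e \<in> A" "e \<notin> far c U v y" using miss yz by blast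
      obtain f where f: "f \<in> A" "f \<notin> far c U v z" using miss yz by blast
      obtain g where g: "g \<in> A" "g \<notin> far c U v w" using miss w by blast
      have D': "D = {y, z, w}" "D = {y, w, z}" "D = {z, w, y}"
        using w by auto
      have efg: "e \<in> far c U v z" "e \<in> far c U v w" "f \<in> far c U v y" "f \<in> far c U v w"
        "g \<in> far c U v y" "g \<in> far c U v z"
        using two[OF e(1) D'(1)] two[OF e(1) D'(2)] two[OF f(1) D'(1)] two[OF f(1) D'(3)]
          two[OF g(1) D'(2)] two[OF g(1) D'(3)] e f g by auto
      have "card {f, g} \<le> card (far c U v y)"
        using efg far_le[OF yz(1)] by (intro card_mono) auto
      moreover have "f \<noteq> g"
        using efg f g by auto
      ultimately have "card (far c U v y) = 2"
        using far_le(2)[OF yz(1), of c] by simp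
      define c1 where "c1 = c(y := e)"
      have c1: "extends c1 U"
        unfolding c1_def using e \<open>card (far c U v y) = 2\<close>
        by (intro recolor'[OF assms(1) yz(1)]) (auto simp: A_def)
      have "f \<notin> c1 ` D"
        using w yz True e f efg by (auto simp: c1_def A_def)
      then obtain p q where pq: "p \<in> D" "q \<in> D" "p \<noteq> q" "c1 p = c1 q"
        "f \<in> far c1 U v p" "f \<in> far c1 U v q"
        using blocked[OF c1, of f] f by (auto simp: A_def)
      then have "f \<in> far c1 U v z"
        using w yz e(1) True by (auto simp: c1_def A_def)
      moreover have "far c1 U v z = far c U v z"
        unfolding c1_def using yz by (intro far_same[OF assms(1)])
      ultimately show False
        using f by simp
    qed
  qed
qed

lemma extend_coloring:
  assumes "partial_coloring c0 S"
  shows "\<exists>c. extends c V"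
proof -
  have S: "S \<subseteq> V" using assms by (simp add: partial_coloring_def)
  have "\<exists>c. extends c (S \<union> W)" if "finite W" "W \<subseteq> V" for W
    using that
  proof (induction W)
    case empty
    then show ?case using assms by (auto simp: extends_def)
  next
    case (insert v W)
    then obtain c where c: "extends c (S \<union> W)" by auto
    show ?case
    proof (cases "v \<in> S \<union> W")
      case True
      then show ?thesis using c by (auto simp: insert_absorb)
    next
      case False
      then show ?thesis using extend_vertex[OF c _ False] insert.prems by simp
    qed
  qed
  from this[OF pair_finite_verts] S show ?thesis
    by (simp add: Un_absorb1)
qed

end

context cubic_graph
begin

section \<open>Locally stuck colorings\<close>

text \<open>In the second case color \<open>l\<close> at \<open>v\<close> would make the cycle
  bicolored. For \<open>l\<close> other than \<open>c v\<close>, requiring \<open>j\<close> to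
  differ from \<open>c v\<close> keeps the rest of the cycle out of the class that is recolored
  together with \<open>v\<close>.\<close>

definition blocked :: "'a set \<Rightarrow> ('a \<Rightarrow> nat) \<Rightarrow> 'a \<Rightarrow> nat
  \<Rightarrow> bool" where
  "blocked S c v l \<longleftrightarrow> (\<exists>u\<in>S. adj v u \<and> c u = l) \<or>
     (\<exists>xs. \<exists>j\<in>{1..4} - {c v}. cyclic_list G (v # xs) \<and> set xs \<subseteq> S
       \<and> c ` set xs \<subseteq> {j, l})"

text \<open>Whatever replacement colors a step chooses, the stuck vertex of the discarded color
  receives one that is blocked inside \<open>S\<close>, where the extension agrees with
  \<open>c0\<close>.\<close>

theorem seed:
  assumes S: "S \<subseteq> V" "c0 ` S \<subseteq> {1..4}" "proper_on G c0 S"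
    and acyclic: "\<And>X. X \<subseteq> S \<Longrightarrow> core G c0 X \<Longrightarrow> False"
    and guard: "\<And>s. s \<in> S \<Longrightarrow> safe S c0 s \<or> (\<exists>t\<in>S. adj s t
      \<and> safe S c0 t)"
    and stuck: "\<And>i. i \<in> {1..4} \<Longrightarrow> \<exists>v\<in>S. c0 v = i \<and>
      (\<forall>l\<in>{1..4} - {i}. blocked S c0 v l)"
  shows "4 \<in> irreducible_color_numbers G"
proof -
  interpret guarded_coloring G S c0
  proof
    fix s v assume "s \<in> S" "adj s v" "v \<notin> S"
    \<comment> \<open>A safe vertex has all its neighbors in \<open>S\<close>, so \<open>s\<close>
      is not safe and the other alternative applies.\<close>
    then show "\<exists>t. adj s t \<and> t \<in> S \<and> safe S c0 t"
      using guard[of s] safe_nbrs[of S c0 s] unfolding nbrs_def by blast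
  qed
  obtain c where c: "extends c V"
    using extend_coloring S acyclic unfolding partial_coloring_def by metis
  then have agree: "\<And>s. s \<in> S \<Longrightarrow> c s = c0 s" and range: "c ` V \<subseteq> {1..4}"
    by (auto simp: extends_def partial_coloring_def)
  have "acyclic_coloring G {1..4} c"
    using c by (intro acyclic_coloringI pair_graph_axioms) (auto simp: extends_def partial_coloring_def)
  moreover have "c ` V = {1..4}"
  proof (intro antisym range subsetI)
    fix i :: nat assume "i \<in> {1..4}"
    then show "i \<in> c ` V"
      using stuck[of i] agree S(1) by (force simp: image_iff)
  qed
  moreover have "\<not> acyclic_recoloring_possible G 4 c"
  proof
    assume "acyclic_recoloring_possible G 4 c"
    then obtain i l where i: "i \<in> {1..4}"
      and l: "\<And>v. v \<in> color_class G c i \<Longrightarrow> l v \<in> {1..4} - {i} \<and> l v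
        \<notin> c ` closed_neighborhood G v"
      and acyc: "acyclic_coloring G ({1..4} - {i}) (\<lambda>v. if c v = i then l v else c v)"
      unfolding acyclic_recoloring_possible_def by blast
    obtain v where v: "v \<in> S" "c0 v = i"
      "\<And>l. l \<in> {1..4} - {i} \<Longrightarrow> blocked S c0 v l"
      using stuck[OF i] by blast
    then have lv: "l v \<in> {1..4} - {i}" "l v \<notin> c ` closed_neighborhood G v"
      using l[of v] S(1) agree by (auto simp: color_class_def)
    from v(3)[OF lv(1)] show False
      unfolding blocked_def
    proof (elim disjE exE bexE conjE)
      fix u assume "u \<in> S" "adj v u" "c0 u = l v"
      then have "u \<in> closed_neighborhood G v" "c u = l v"
        using agree by (auto simp: closed_neighborhood_def)
      then show False
        using lv(2) by (metis imageI)
    next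
      fix xs j assume j: "j \<in> {1..4} - {c0 v}" and xs: "cyclic_list G (v # xs)" "set xs \<subseteq> S"
        "c0 ` set xs \<subseteq> {j, l v}"
      show False
      proof (rule acyclic_coloring_cyclic_list[OF acyc xs(1)])
        show "set (v # xs) \<subseteq> V" using v(1) xs(2) S(1) by auto
        have "c x \<in> {j, l v}" if "x \<in> set xs" for x
          using that xs agree by auto
        moreover have "i \<noteq> j" "i \<noteq> l v"
          using j v(2) lv by auto
        ultimately have "c x \<in> {j, l v}" "c x \<noteq> i" if "x \<in> set xs" for x
          using that by force+
        then show "(\<lambda>v. if c v = i then l v else c v) ` set (v # xs) \<subseteq> {j, l v}"
          using v agree[OF v(1)] by auto
        show "j \<in> {1..4} - {i}" "l v \<in> {1..4} - {i}"
          using j v(2) lv by auto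
      qed
    qed
  qed
  ultimately show ?thesis
    by (auto simp: irreducible_color_numbers_def)
qed

end

section \<open>Neighborhoods and criteria for stuck seeds\<close>

context cubic_graph
begin

lemma nbrs_cases:
  assumes "v \<in> V"
  obtains p q r where "nbrs v = {p, q, r}" "p \<noteq> q" "p \<noteq> r" "q \<noteq> r"
  using card_nbrs[OF assms] by (auto simp: card_3_iff)

lemma nbrs_cases1:
  assumes "adj v p"
  obtains q r where "nbrs v = {p, q, r}" "p \<noteq> q" "p \<noteq> r" "q \<noteq> r"
proof -
  obtain a b c where n: "nbrs v = {a, b, c}" "a \<noteq> b" "a \<noteq> c" "b \<noteq> c"
    using nbrs_cases adj_in_V(1)[OF assms] by blast
  have "p \<in> nbrs v" using assms by (simp add: nbrs_def)
  then have "p = a \<or> p = b \<or> p = c" using n by auto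
  then show ?thesis
    using that n by (elim disjE) (metis insert_commute)+
qed

lemma nbrs_cases2:
  assumes "adj v p" "adj v q" "p \<noteq> q"
  obtains r where "nbrs v = {p, q, r}" "p \<noteq> r" "q \<noteq> r"
proof -
  obtain a b where n: "nbrs v = {p, a, b}" "p \<noteq> a" "p \<noteq> b" "a \<noteq> b"
    using nbrs_cases1[OF assms(1)] .
  have "q \<in> nbrs v" using assms by (simp add: nbrs_def)
  then have "q = a \<or> q = b" using n assms(3) by auto
  then show ?thesis
    using that n by (elim disjE) (metis insert_commute)+
qed

lemma adj_nbrs: "nbrs v = {p, q, r} \<Longrightarrow> adj v u \<longleftrightarrow> u = p \<or> u = q
  \<or> u = r"
  by (auto simp: nbrs_def)

lemma nbrs_neq: "nbrs v = {p, q, r} \<Longrightarrow> v \<noteq> p \<and> v \<noteq> q \<and> v \<noteq> r"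
  using not_adj_self[of v] adj_nbrs[of v p q r v] by blast

lemma safe3:
  assumes "nbrs t = {p, q, r}" "p \<in> S" "q \<in> S" "r \<in> S"
    "c p = c q \<longrightarrow> safe S c p \<or> safe S c q"
    "c p = c r \<longrightarrow> safe S c p \<or> safe S c r"
    "c q = c r \<longrightarrow> safe S c q \<or> safe S c r"
  shows "safe S c t"
  by (rule safeI) (use assms in auto)

definition stuck :: "'a set \<Rightarrow> ('a \<Rightarrow> nat) \<Rightarrow> 'a \<Rightarrow> bool" where
  "stuck S c v \<longleftrightarrow> v \<in> S \<and> (\<forall>l\<in>{1..4} - {c v}. blocked S c v l)"

lemma nat_1_4: "{1..4} = {1, 2, 3, 4::nat}"
  by auto

lemma stuckI:
  assumes "v \<in> S" "c v = 1 \<or> blocked S c v 1" "c v = 2 \<or> blocked S c v 2"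
    "c v = 3 \<or> blocked S c v 3" "c v = 4 \<or> blocked S c v 4"
  shows "stuck S c v"
  using assms unfolding stuck_def nat_1_4 by auto

lemma blocked_nbr: "\<lbrakk>adj v u; u \<in> S; c u = l\<rbrakk> \<Longrightarrow> blocked S c v l"
  by (auto simp: blocked_def)

lemma stuck_rainbow:
  assumes "v \<in> S" "nbrs v = {p, q, r}" "p \<in> S" "q \<in> S" "r \<in> S"
    "{1, 2, 3, 4} \<subseteq> {c v, c p, c q, c r}"
  shows "stuck S c v"
proof -
  have "blocked S c v l" if "l \<in> {1..4} - {c v}" for l
  proof -
    have "l \<in> {1, 2, 3, 4}" "l \<noteq> c v"
      using that unfolding nat_1_4 by auto
    with subsetD[OF assms(6), of l] have "l = c p \<or> l = c q \<or> l = c r"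
      by simp
    moreover have "adj v p" "adj v q" "adj v r"
      using adj_nbrs[OF assms(2)] by auto
    ultimately show ?thesis
      using blocked_nbr assms(3-5) by (elim disjE) simp_all
  qed
  then show ?thesis
    using assms(1) by (simp add: stuck_def)
qed

lemma blocked_4_cycle:
  assumes "adj v p" "adj p q" "adj q r" "adj r v" "p \<noteq> r" "q \<noteq> v" "{p, q, r} \<subseteq> S"
    "c p = c r" "c q = l" "c p \<in> {1..4}" "c p \<noteq> c v"
  shows "blocked S c v l"
proof -
  have "cyclic_list G (v # [p, q, r])"
    using assms by (auto simp: cyclic_list_def)
  moreover have "set [p, q, r] \<subseteq> S" "c ` set [p, q, r] \<subseteq> {c p, l}"
    using assms by auto
  ultimately show ?thesis
    unfolding blocked_def using assms(10,11) by blast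
qed

lemma blocked_6_cycle:
  assumes "adj v p" "adj p q" "adj q r" "adj r s" "adj s t" "adj t v" "distinct [v, p, q, r, s, t]"
    "{p, q, r, s, t} \<subseteq> S" "c r = c p" "c t = c p" "c q = l" "c s = l" "c p \<in> {1..4}"
    "c p \<noteq> c v"
  shows "blocked S c v l"
proof -
  have "cyclic_list G (v # [p, q, r, s, t])"
    using assms by (auto simp: cyclic_list_def)
  moreover have "set [p, q, r, s, t] \<subseteq> S" "c ` set [p, q, r, s, t] \<subseteq> {c p, l}"
    using assms by auto
  ultimately show ?thesis
    unfolding blocked_def using assms(13,14) by blast
qed

text \<open>\<open>L\<close> collects the seed vertices whose safety is left open. A core avoids
  safe vertices, hence lies in \<open>L\<close>, and it suffices to exclude its alternating path
  there.\<close>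

lemma stuck_seed:
  assumes S: "S \<subseteq> V" "c ` S \<subseteq> {1..4}" "proper_on G c S"
    and L: "\<And>s. s \<in> S \<Longrightarrow> safe S c s \<or> s \<in> L \<and> (\<exists>t\<in>S.
      adj s t \<and> safe S c t)"
    and no_core: "\<And>x y z x' x''. \<lbrakk>x \<in> L; y \<in> L; z \<in> L; x' \<in> L; x'' \<in>
      L; adj x y; adj x z; y \<noteq> z; c y = c z;
      adj y x'; x' \<noteq> x; c x' = c x; adj z x''; x'' \<noteq> x; c x'' = c x; c y \<noteq> c
        x\<rbrakk> \<Longrightarrow> False"
    and stuck: "stuck S c v1" "c v1 = 1" "stuck S c v2" "c v2 = 2" "stuck S c v3" "c v3 = 3"
      "stuck S c v4" "c v4 = 4"
  shows "4 \<in> irreducible_color_numbers G"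
proof (rule seed[OF S])
  fix X assume X: "X \<subseteq> S" "core G c X"
  note proper = proper_on_subset[OF S(3) X(1)]
  have "X \<subseteq> L"
    using safe_not_core[of S c _ c, OF _ refl X(2) proper] L X(1) by blast
  then show False
    using core_path[OF X(2) proper] no_core by (smt (verit) subsetD)
next
  show "safe S c s \<or> (\<exists>t\<in>S. adj s t \<and> safe S c t)" if "s \<in> S" for s
    using L[OF that] by blast
next
  show "\<exists>v\<in>S. c v = i \<and> (\<forall>l\<in>{1..4} - {i}. blocked S c v l)" if
    "i \<in> {1..4}" for i
  proof -
    have "i = 1 \<or> i = 2 \<or> i = 3 \<or> i = 4" using that by auto
    then show ?thesis
      using stuck unfolding stuck_def by (elim disjE) auto
  qed
qed

lemma stuck_seed_inj:
  assumes "S \<subseteq> V" "c ` S \<subseteq> {1..4}" "proper_on G c S"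
    and "\<And>s. s \<in> S \<Longrightarrow> safe S c s \<or> s \<in> L \<and> (\<exists>t\<in>S. adj
      s t \<and> safe S c t)"
    and "inj_on c L"
    and "stuck S c v1" "c v1 = 1" "stuck S c v2" "c v2 = 2" "stuck S c v3" "c v3 = 3"
      "stuck S c v4" "c v4 = 4"
  shows "4 \<in> irreducible_color_numbers G"
  by (rule stuck_seed[OF assms(1-4) _ assms(6-13)]) (use assms(5) in \<open>auto dest: inj_onD\<close>)


section \<open>Explicit seeds around short cycles and in balls\<close>

lemma irreducible_K4:
  assumes n: "nbrs v = {a, b, c}" "nbrs a = {v, b, c}" "nbrs b = {v, a, c}" "nbrs c = {v, a, b}"
    and d: "distinct [v, a, b, c]"
  shows "4 \<in> irreducible_color_numbers G"
proof -
  define f where "f = (\<lambda>_. 0::nat)(v := 4, a := 1, b := 2, c := 3)"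
  have f: "f v = 4" "f a = 1" "f b = 2" "f c = 3"
    using d by (auto simp: f_def)
  let ?S = "{v, a, b, c}"
  have v_safe: "safe ?S f v"
    by (rule safe3[OF n(1)]) (simp_all add: f)
  have a_safe: "safe ?S f a"
    by (rule safe3[OF n(2)]) (simp_all add: f)
  have b_safe: "safe ?S f b"
    by (rule safe3[OF n(3)]) (simp_all add: f)
  have c_safe: "safe ?S f c"
    by (rule safe3[OF n(4)]) (simp_all add: f)
  note safe = v_safe a_safe b_safe c_safe
  have "stuck ?S f v"
    by (rule stuck_rainbow[OF _ n(1)]) (simp_all add: f)
  moreover have "stuck ?S f a"
    by (rule stuck_rainbow[OF _ n(2)]) (simp_all add: f)
  moreover have "stuck ?S f b"
    by (rule stuck_rainbow[OF _ n(3)]) (simp_all add: f)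
  moreover have "stuck ?S f c"
    by (rule stuck_rainbow[OF _ n(4)]) (simp_all add: f)
  moreover have "?S \<subseteq> V"
    using nbrs_subset[of v] nbrs_subset[of a] n by auto
  moreover have "proper_on G f ?S"
    by (auto simp: proper_on_def f)
  ultimately show ?thesis
    using safe f by (intro stuck_seed_inj[of ?S f "{}" a b c v]) auto
qed

text \<open>Among their diamond neighbors the nonadjacent \<open>p\<close> and \<open>q\<close> miss
  only the color of each other, and the outer neighbors \<open>p'\<close> and \<open>q'\<close>
  supply it. All four diamond vertices then see every other color.\<close>

lemma irreducible_diamond_apart:
  assumes n: "nbrs x = {y, p, q}" "nbrs y = {x, p, q}" "nbrs p = {x, y, p'}" "nbrs q = {x, y, q'}"
    and d: "distinct [x, y, p, q, p', q']"
  shows "4 \<in> irreducible_color_numbers G"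
proof -
  define f where "f = (\<lambda>_. 0::nat)(x := 1, y := 2, p := 3, q := 4, p' := 4, q' := 3)"
  have f: "f x = 1" "f y = 2" "f p = 3" "f q = 4" "f p' = 4" "f q' = 3"
    using d by (auto simp: f_def)
  let ?S = "{x, y, p, q, p', q'}"
  have adj: "\<And>u. adj x u \<longleftrightarrow> u = y \<or> u = p \<or> u = q"
    "\<And>u. adj y u \<longleftrightarrow> u = x \<or> u = p \<or> u = q"
    "\<And>u. adj p u \<longleftrightarrow> u = x \<or> u = y \<or> u = p'"
    "\<And>u. adj q u \<longleftrightarrow> u = x \<or> u = y \<or> u = q'"
    using n[THEN adj_nbrs] by auto
  have sym: "adj p' p" "adj q' q" "\<not> adj p' q" "\<not> adj q' p"
    using d by (auto simp: adj adj_commute[of p'] adj_commute[of q'])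
  have x_safe: "safe ?S f x"
    by (rule safe3[OF n(1)]) (simp_all add: f)
  have y_safe: "safe ?S f y"
    by (rule safe3[OF n(2)]) (simp_all add: f)
  have p_safe: "safe ?S f p"
    by (rule safe3[OF n(3)]) (simp_all add: f)
  have q_safe: "safe ?S f q"
    by (rule safe3[OF n(4)]) (simp_all add: f)
  note safe = x_safe y_safe p_safe q_safe
  have "stuck ?S f x"
    by (rule stuck_rainbow[OF _ n(1)]) (simp_all add: f)
  moreover have "stuck ?S f y"
    by (rule stuck_rainbow[OF _ n(2)]) (simp_all add: f)
  moreover have "stuck ?S f p"
    by (rule stuck_rainbow[OF _ n(3)]) (simp_all add: f)
  moreover have "stuck ?S f q"
    by (rule stuck_rainbow[OF _ n(4)]) (simp_all add: f)
  moreover have "?S \<subseteq> V"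
    using nbrs_subset[of x] nbrs_subset[of y] nbrs_subset[of p] nbrs_subset[of q] n by auto
  moreover have "proper_on G f ?S"
    using d sym by (auto simp: proper_on_def f adj)
  moreover have "inj_on f {p', q'}"
    by (auto simp: f)
  ultimately show ?thesis
    using safe f sym by (intro stuck_seed_inj[of ?S f "{p', q'}" x y p q]) auto
qed

text \<open>The common outer neighbor \<open>z\<close> cannot supply two colors, so \<open>p\<close>
  and \<open>q\<close> share color 3. They still see everything, while \<open>x\<close>,
  \<open>y\<close> and \<open>z\<close> are held by 4-cycles through \<open>p\<close> and
  \<open>q\<close>.\<close>

lemma irreducible_diamond_joined:
  assumes n: "nbrs x = {y, p, q}" "nbrs y = {x, p, q}" "nbrs p = {x, y, z}" "nbrs q = {x, y, z}"
    and d: "distinct [x, y, p, q, z]"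
  shows "4 \<in> irreducible_color_numbers G"
proof -
  define f where "f = (\<lambda>_. 0::nat)(x := 1, y := 2, p := 3, q := 3, z := 4)"
  have f: "f x = 1" "f y = 2" "f p = 3" "f q = 3" "f z = 4"
    using d by (auto simp: f_def)
  let ?S = "{x, y, p, q, z}"
  have adj: "\<And>u. adj x u \<longleftrightarrow> u = y \<or> u = p \<or> u = q"
    "\<And>u. adj y u \<longleftrightarrow> u = x \<or> u = p \<or> u = q"
    "\<And>u. adj p u \<longleftrightarrow> u = x \<or> u = y \<or> u = z"
    "\<And>u. adj q u \<longleftrightarrow> u = x \<or> u = y \<or> u = z"
    using n[THEN adj_nbrs] by auto
  have sym: "adj z p" "adj z q"
    by (auto simp: adj adj_commute[of z])
  have p_safe: "safe ?S f p"
    by (rule safe3[OF n(3)]) (simp_all add: f)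
  have q_safe: "safe ?S f q"
    by (rule safe3[OF n(4)]) (simp_all add: f)
  note safe = p_safe q_safe
  have "blocked ?S f x 4"
    by (rule blocked_4_cycle[of _ p z q]) (use d sym in \<open>auto simp: f adj\<close>)
  moreover have "blocked ?S f y 4"
    by (rule blocked_4_cycle[of _ p z q]) (use d sym in \<open>auto simp: f adj\<close>)
  moreover have "blocked ?S f z 1"
    by (rule blocked_4_cycle[of _ p x q]) (use d sym in \<open>auto simp: f adj\<close>)
  moreover have "blocked ?S f z 2"
    by (rule blocked_4_cycle[of _ p y q]) (use d sym in \<open>auto simp: f adj\<close>)
  ultimately have "stuck ?S f x" "stuck ?S f y" "stuck ?S f z"
    using sym blocked_nbr[of x p ?S f 3] blocked_nbr[of x y ?S f 2] blocked_nbr[of y p ?S f 3]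
      blocked_nbr[of y x ?S f 1] blocked_nbr[of z p ?S f 3]
    by (auto intro!: stuckI simp: f adj)
  moreover have "stuck ?S f p"
    by (rule stuck_rainbow[OF _ n(3)]) (simp_all add: f)
  moreover have "?S \<subseteq> V"
    using nbrs_subset[of x] nbrs_subset[of y] nbrs_subset[of p] n by auto
  moreover have "proper_on G f ?S"
    using d by (auto simp: proper_on_def f adj)
  moreover have "inj_on f {x, y, z}"
    by (auto simp: f)
  ultimately show ?thesis
    using safe f sym adj by (intro stuck_seed_inj[of ?S f "{x, y, z}" x y p z]) auto
qed

text \<open>With \<open>x\<close> and \<open>y\<close> in one color, any two of \<open>p\<close>,
  \<open>q\<close>, \<open>r\<close> are opposite on a 4-cycle through \<open>x\<close> and
  \<open>y\<close>, so each blocks its color at the others.\<close>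

lemma irreducible_K23:
  assumes n: "nbrs x = {p, q, r}" "nbrs y = {p, q, r}" and d: "distinct [x, y, p, q, r]"
  shows "4 \<in> irreducible_color_numbers G"
proof -
  define f where "f = (\<lambda>_. 0::nat)(x := 4, y := 4, p := 1, q := 2, r := 3)"
  have f: "f x = 4" "f y = 4" "f p = 1" "f q = 2" "f r = 3"
    using d by (auto simp: f_def)
  let ?S = "{x, y, p, q, r}"
  have adj: "\<And>u. adj x u \<longleftrightarrow> u = p \<or> u = q \<or> u = r"
    "\<And>u. adj y u \<longleftrightarrow> u = p \<or> u = q \<or> u = r"
    using n[THEN adj_nbrs] by auto
  have sym: "adj p x" "adj p y" "adj q x" "adj q y" "adj r x" "adj r y"
    by (auto simp: adj adj_commute[of _ x] adj_commute[of _ y])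
  have x_safe: "safe ?S f x"
    by (rule safe3[OF n(1)]) (simp_all add: f)
  have y_safe: "safe ?S f y"
    by (rule safe3[OF n(2)]) (simp_all add: f)
  note safe = x_safe y_safe
  have bl: "blocked ?S f u (f w)" if "u \<in> {p, q, r}" "w \<in> {p, q, r}" "u \<noteq> w" for u w
    using d sym that by (intro blocked_4_cycle[of _ x w y]) (auto simp: f adj)
  have "stuck ?S f p" "stuck ?S f q" "stuck ?S f r"
    using d sym bl[of p q] bl[of p r] bl[of q p] bl[of q r] bl[of r p] bl[of r q]
      blocked_nbr[of p x ?S f 4] blocked_nbr[of q x ?S f 4] blocked_nbr[of r x ?S f 4]
    by (auto intro!: stuckI simp: f)
  moreover have "stuck ?S f x"
    by (rule stuck_rainbow[OF _ n(1)]) (simp_all add: f)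
  moreover have "?S \<subseteq> V"
    using nbrs_subset[of x] n adj_in_V[OF sym(1)] adj_in_V[OF sym(2)] by auto
  moreover have "proper_on G f ?S"
    using d by (auto simp: proper_on_def f adj)
  moreover have "inj_on f {p, q, r}"
    by (auto simp: f)
  ultimately show ?thesis
    using safe f sym adj by (intro stuck_seed_inj[of ?S f "{p, q, r}" p q r x]) auto
qed

text \<open>Each outer vertex repeats the color opposite to its neighbor on the cycle, the one color
  missing there. The outer colors are all different, so edges among the outer vertices do no
  harm.\<close>

lemma irreducible_4_cycle:
  assumes n: "nbrs v1 = {v2, v4, w1}" "nbrs v2 = {v1, v3, w2}" "nbrs v3 = {v2, v4, w3}"
    "nbrs v4 = {v1, v3, w4}"
    and d: "distinct [v1, v2, v3, v4, w1, w2, w3, w4]"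
  shows "4 \<in> irreducible_color_numbers G"
proof -
  define f where "f = (\<lambda>_. 0::nat)
    (v1 := 1, v2 := 2, v3 := 3, v4 := 4, w1 := 3, w2 := 4, w3 := 1, w4 := 2)"
  have f: "f v1 = 1" "f v2 = 2" "f v3 = 3" "f v4 = 4" "f w1 = 3" "f w2 = 4" "f w3 = 1" "f w4 = 2"
    using d by (auto simp: f_def)
  let ?S = "{v1, v2, v3, v4, w1, w2, w3, w4}"
  have adj: "\<And>u. adj v1 u \<longleftrightarrow> u = v2 \<or> u = v4 \<or> u = w1"
    "\<And>u. adj v2 u \<longleftrightarrow> u = v1 \<or> u = v3 \<or> u = w2"
    "\<And>u. adj v3 u \<longleftrightarrow> u = v2 \<or> u = v4 \<or> u = w3"
    "\<And>u. adj v4 u \<longleftrightarrow> u = v1 \<or> u = v3 \<or> u = w4"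
    using n[THEN adj_nbrs] by auto
  have sym: "adj w1 v1" "adj w2 v2" "adj w3 v3" "adj w4 v4"
    "\<not> adj w1 v3" "\<not> adj w2 v4" "\<not> adj w3 v1" "\<not> adj w4 v2"
    using d by (auto simp: adj adj_commute[of w1] adj_commute[of w2] adj_commute[of w3] adj_commute[of w4])
  have v1_safe: "safe ?S f v1"
    by (rule safe3[OF n(1)]) (simp_all add: f)
  have v2_safe: "safe ?S f v2"
    by (rule safe3[OF n(2)]) (simp_all add: f)
  have v3_safe: "safe ?S f v3"
    by (rule safe3[OF n(3)]) (simp_all add: f)
  have v4_safe: "safe ?S f v4"
    by (rule safe3[OF n(4)]) (simp_all add: f)
  note safe = v1_safe v2_safe v3_safe v4_safe
  have "stuck ?S f v1"
    by (rule stuck_rainbow[OF _ n(1)]) (simp_all add: f)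
  moreover have "stuck ?S f v2"
    by (rule stuck_rainbow[OF _ n(2)]) (simp_all add: f)
  moreover have "stuck ?S f v3"
    by (rule stuck_rainbow[OF _ n(3)]) (simp_all add: f)
  moreover have "stuck ?S f v4"
    by (rule stuck_rainbow[OF _ n(4)]) (simp_all add: f)
  moreover have "?S \<subseteq> V"
    using nbrs_subset[of v1] nbrs_subset[of v2] nbrs_subset[of v3] nbrs_subset[of v4] n by auto
  moreover have "proper_on G f ?S"
    using d sym by (auto simp: proper_on_def f adj)
  moreover have "inj_on f {w1, w2, w3, w4}"
    by (auto simp: f)
  ultimately show ?thesis
    using safe f sym by (intro stuck_seed_inj[of ?S f "{w1, w2, w3, w4}" v1 v2 v3 v4]) auto
qed


text \<open>All outer neighbors take color 4, and \<open>p\<close>, \<open>q\<close> let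
  \<open>x'\<close> see the three others. Color 4 is the only one repeated in the set left for
  cores, while a core repeats both of its colors.\<close>

lemma irreducible_triangle_apart:
  assumes n: "nbrs x = {y, z, x'}" "nbrs y = {x, z, y'}" "nbrs z = {x, y, z'}" "nbrs x' = {x, p, q}"
    and d: "distinct [x, y, z, x', y', z', p, q]"
    and na: "\<not> adj y' z'"
  shows "4 \<in> irreducible_color_numbers G"
proof -
  define f where "f = (\<lambda>_. 0::nat)(x := 1, y := 2, z := 3, x' := 4, y' := 4, z' := 4, p := 2, q
    := 3)"
  have f: "f x = 1" "f y = 2" "f z = 3" "f x' = 4" "f y' = 4" "f z' = 4" "f p = 2" "f q = 3"
    using d by (auto simp: f_def)
  let ?S = "{x, y, z, x', y', z', p, q}"
  have adj: "\<And>u. adj x u \<longleftrightarrow> u = y \<or> u = z \<or> u = x'"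
    "\<And>u. adj y u \<longleftrightarrow> u = x \<or> u = z \<or> u = y'"
    "\<And>u. adj z u \<longleftrightarrow> u = x \<or> u = y \<or> u = z'"
    "\<And>u. adj x' u \<longleftrightarrow> u = x \<or> u = p \<or> u = q"
    using n[THEN adj_nbrs] by auto
  have sym: "\<not> adj y' z'" "\<not> adj z' y'" "adj y' y" "adj z' z" "adj p x'" "adj q x'"
    "\<not> adj y' x'" "\<not> adj z' x'" "\<not> adj p y" "\<not> adj q z"
    using d na by (auto simp: adj adj_commute[of y' y] adj_commute[of z' z]
      adj_commute[of _ x'] adj_commute[of p y] adj_commute[of q z] adj_commute[of z' y'])
  have x_safe: "safe ?S f x"
    by (rule safe3[OF n(1)]) (simp_all add: f)
  have y_safe: "safe ?S f y"
    by (rule safe3[OF n(2)]) (simp_all add: f x_safe)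
  have z_safe: "safe ?S f z"
    by (rule safe3[OF n(3)]) (simp_all add: f x_safe y_safe)
  have xp_safe: "safe ?S f x'"
    by (rule safe3[OF n(4)]) (simp_all add: f x_safe y_safe z_safe)
  note safe = x_safe y_safe z_safe xp_safe
  have "stuck ?S f x"
    by (rule stuck_rainbow[OF _ n(1)]) (simp_all add: f)
  moreover have "stuck ?S f y"
    by (rule stuck_rainbow[OF _ n(2)]) (simp_all add: f)
  moreover have "stuck ?S f z"
    by (rule stuck_rainbow[OF _ n(3)]) (simp_all add: f)
  moreover have "stuck ?S f x'"
    by (rule stuck_rainbow[OF _ n(4)]) (simp_all add: f)
  moreover have "?S \<subseteq> V"
    using nbrs_subset[of x] nbrs_subset[of y] nbrs_subset[of z] nbrs_subset[of x'] n by auto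
  moreover have "proper_on G f ?S"
    using d sym by (auto simp: proper_on_def f adj)
  ultimately show ?thesis
    using safe f sym d by (intro stuck_seed[of ?S f "{y', z', p, q}" x y z x']) auto
qed

text \<open>The adjacent \<open>x'\<close> and \<open>y'\<close> cannot both take color 4. Giving
  \<open>x'\<close> the color of \<open>y\<close> makes them opposite on the 4-cycle
  \<open>x y y' x'\<close>, which blocks 4 at \<open>x\<close> and 1 at \<open>y'\<close>.\<close>

lemma irreducible_triangle_joined:
  assumes n: "nbrs x = {y, z, x'}" "nbrs y = {x, z, y'}" "nbrs z = {x, y, z'}" "nbrs y' = {y, x', q}"
    and d: "distinct [x, y, z, x', y', z', q]"
  shows "4 \<in> irreducible_color_numbers G"
proof -
  define f where "f = (\<lambda>_. 0::nat)(x := 1, y := 2, z := 3, x' := 2, y' := 4, z' := 4, q := 3)"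
  have f: "f x = 1" "f y = 2" "f z = 3" "f x' = 2" "f y' = 4" "f z' = 4" "f q = 3"
    using d by (auto simp: f_def)
  let ?S = "{x, y, z, x', y', z', q}"
  have adj: "\<And>u. adj x u \<longleftrightarrow> u = y \<or> u = z \<or> u = x'"
    "\<And>u. adj y u \<longleftrightarrow> u = x \<or> u = z \<or> u = y'"
    "\<And>u. adj z u \<longleftrightarrow> u = x \<or> u = y \<or> u = z'"
    "\<And>u. adj y' u \<longleftrightarrow> u = y \<or> u = x' \<or> u = q"
    using n[THEN adj_nbrs] by auto
  have sym: "adj x' x" "adj x' y'" "adj z' z" "adj q y'" "\<not> adj x' y" "\<not> adj z' y'"
    "\<not> adj q z"
    using d by (auto simp: adj adj_commute[of x' x] adj_commute[of x' y]
      adj_commute[of x' y'] adj_commute[of z'] adj_commute[of q])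
  have y_safe: "safe ?S f y"
    by (rule safe3[OF n(2)]) (simp_all add: f)
  have z_safe: "safe ?S f z"
    by (rule safe3[OF n(3)]) (simp_all add: f y_safe)
  have x_safe: "safe ?S f x"
    by (rule safe3[OF n(1)]) (simp_all add: f y_safe z_safe)
  have yp_safe: "safe ?S f y'"
    by (rule safe3[OF n(4)]) (simp_all add: f y_safe z_safe x_safe)
  note safe = y_safe z_safe x_safe yp_safe
  have "stuck ?S f x"
    using sym blocked_nbr[of x y ?S f 2] blocked_nbr[of x z ?S f 3]
      blocked_4_cycle[of x y y' x' ?S f 4] d by (auto intro!: stuckI simp: f adj)
  moreover have "stuck ?S f y'"
    using sym blocked_nbr[of y' y ?S f 2] blocked_nbr[of y' q ?S f 3]
      blocked_4_cycle[of y' y x x' ?S f 1] d by (auto intro!: stuckI simp: f adj)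
  moreover have "stuck ?S f y"
    by (rule stuck_rainbow[OF _ n(2)]) (simp_all add: f)
  moreover have "stuck ?S f z"
    by (rule stuck_rainbow[OF _ n(3)]) (simp_all add: f)
  moreover have "?S \<subseteq> V"
    using nbrs_subset[of x] nbrs_subset[of y] nbrs_subset[of z] nbrs_subset[of y'] n by auto
  moreover have "proper_on G f ?S"
    using d sym by (auto simp: proper_on_def f adj)
  moreover have "inj_on f {x', q, z'}"
    by (auto simp: f)
  ultimately show ?thesis
    using safe f sym by (intro stuck_seed_inj[of ?S f "{x', q, z'}" x y z y']) auto
qed

text \<open>Each of \<open>a\<close>, \<open>b\<close>, \<open>c\<close> gets the two colors it
  misses on its leaves. The pairs of equally colored leaves in different branches are the three
  excluded adjacencies. As every leaf color occurs exactly twice, a core among the leaves would be a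
  4-cycle.\<close>

lemma irreducible_rainbow_ball:
  assumes n: "nbrs v = {a, b, c}" "nbrs a = {v, a1, a2}" "nbrs b = {v, b1, b2}" "nbrs c = {v, c1, c2}"
    and d: "distinct [v, a, b, c, a1, a2, b1, b2, c1, c2]"
    and na: "\<not> adj a2 b2" "\<not> adj a1 c1" "\<not> adj b1 c2"
    and no_4_cycle: "\<And>x y z w. \<lbrakk>{x, y, z, w} \<subseteq> {a1, a2, b1, b2, c1, c2};
      adj x y; adj y z; adj z w; adj w x\<rbrakk> \<Longrightarrow> x = z \<or> y = w"
  shows "4 \<in> irreducible_color_numbers G"
proof -
  define f where "f = (\<lambda>_. 0::nat)(v := 4, a := 1, b := 2, c := 3, a1 := 2, a2 := 3, b1 := 1,
    b2 := 3, c1 := 2, c2 := 1)"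
  have f: "f v = 4" "f a = 1" "f b = 2" "f c = 3" "f a1 = 2" "f a2 = 3" "f b1 = 1" "f b2 = 3"
    "f c1 = 2" "f c2 = 1"
    using d by (auto simp: f_def)
  let ?S = "{v, a, b, c, a1, a2, b1, b2, c1, c2}"
  have adj: "\<And>u. adj v u \<longleftrightarrow> u = a \<or> u = b \<or> u = c"
    "\<And>u. adj a u \<longleftrightarrow> u = v \<or> u = a1 \<or> u = a2"
    "\<And>u. adj b u \<longleftrightarrow> u = v \<or> u = b1 \<or> u = b2"
    "\<And>u. adj c u \<longleftrightarrow> u = v \<or> u = c1 \<or> u = c2"
    using n[THEN adj_nbrs] by auto
  have sym: "\<not> adj a2 b2" "\<not> adj a1 c1" "\<not> adj b1 c2" "\<not> adj b2 a2"
    "\<not> adj c1 a1" "\<not> adj c2 b1"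
    "adj a1 a" "adj a2 a" "adj b1 b" "adj b2 b" "adj c1 c" "adj c2 c"
    "\<not> adj a2 c" "\<not> adj b2 c" "\<not> adj a1 b" "\<not> adj c1 b" "\<not> adj b1 a"
    "\<not> adj c2 a"
    using na d by (auto simp: adj adj_commute[of _ a] adj_commute[of _ b]
      adj_commute[of _ c] adj_commute[of b2 a2] adj_commute[of c1 a1] adj_commute[of c2 b1])
  have v_safe: "safe ?S f v"
    by (rule safe3[OF n(1)]) (simp_all add: f)
  have a_safe: "safe ?S f a"
    by (rule safe3[OF n(2)]) (simp_all add: f v_safe)
  have b_safe: "safe ?S f b"
    by (rule safe3[OF n(3)]) (simp_all add: f v_safe a_safe)
  have c_safe: "safe ?S f c"
    by (rule safe3[OF n(4)]) (simp_all add: f v_safe a_safe b_safe)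
  note safe = v_safe a_safe b_safe c_safe
  have v_stuck: "stuck ?S f v"
    by (rule stuck_rainbow[OF _ n(1)]) (simp_all add: f)
  have a_stuck: "stuck ?S f a"
    by (rule stuck_rainbow[OF _ n(2)]) (simp_all add: f)
  have b_stuck: "stuck ?S f b"
    by (rule stuck_rainbow[OF _ n(3)]) (simp_all add: f)
  have c_stuck: "stuck ?S f c"
    by (rule stuck_rainbow[OF _ n(4)]) (simp_all add: f)
  have sub: "?S \<subseteq> V"
    using nbrs_subset[of v] nbrs_subset[of a] nbrs_subset[of b] nbrs_subset[of c] n by auto
  have proper: "proper_on G f ?S"
    using d sym by (auto simp: proper_on_def f adj)
  have guard: "safe ?S f s \<or> s \<in> {a1, a2, b1, b2, c1, c2} \<and> (\<exists>t\<in>?S. adj s t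
    \<and> safe ?S f t)"
    if "s \<in> ?S" for s
    using that safe sym(7-12) by auto
  show ?thesis
  proof (rule stuck_seed[OF sub _ proper guard])
    fix x y z x' x''
    let ?L = "{a1, a2, b1, b2, c1, c2}"
    assume L: "x \<in> ?L" "y \<in> ?L" "z \<in> ?L" "x' \<in> ?L" "x'' \<in> ?L"
      and h: "adj x y" "adj x z" "y \<noteq> z" "adj y x'" "x' \<noteq> x" "f x' = f x" "adj z x''"
        "x'' \<noteq> x" "f x'' = f x"
    have "x' = x''"
      using L(1,4,5) h(5,6,8,9) f by (elim insertE emptyE) simp_all
    then show False
      using no_4_cycle[of x y x' z] L h adj_sym by auto
  qed (use v_stuck a_stuck b_stuck c_stuck f in simp_all)
qed

text \<open>Color 1 is given to the independent set \<open>a\<close>, \<open>b\<close>,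
  \<open>c1\<close>, \<open>c2\<close>. Its complement consists of the disjoint edges
  \<open>v c\<close>, \<open>a1 b1\<close>, \<open>a2 b2\<close>, colored with the three pairs from
  2, 3, 4. Each of \<open>v\<close>, \<open>a1\<close>, \<open>a2\<close> misses one color, and a
  6-cycle through it alternates between color 1 and the missing color elsewhere.\<close>

lemma irreducible_Petersen:
  assumes n: "nbrs v = {a, b, c}" "nbrs a = {v, a1, a2}" "nbrs b = {v, b1, b2}" "nbrs c = {v, c1, c2}"
    "nbrs a1 = {a, b1, c1}" "nbrs a2 = {a, b2, c2}" "nbrs b1 = {b, a1, c2}" "nbrs b2 = {b, a2, c1}"
    "nbrs c1 = {c, a1, b2}" "nbrs c2 = {c, a2, b1}"
    and d: "distinct [v, a, b, c, a1, a2, b1, b2, c1, c2]"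
  shows "4 \<in> irreducible_color_numbers G"
proof -
  define f where "f = (\<lambda>_. 0::nat)(v := 4, a := 1, b := 1, c := 2, a1 := 2, a2 := 3, b1 := 3,
    b2 := 4, c1 := 1, c2 := 1)"
  have f: "f v = 4" "f a = 1" "f b = 1" "f c = 2" "f a1 = 2" "f a2 = 3" "f b1 = 3" "f b2 = 4"
    "f c1 = 1" "f c2 = 1"
    using d by (auto simp: f_def)
  let ?S = "{v, a, b, c, a1, a2, b1, b2, c1, c2}"
  have adj: "\<And>u. adj v u \<longleftrightarrow> u = a \<or> u = b \<or> u = c"
    "\<And>u. adj a u \<longleftrightarrow> u = v \<or> u = a1 \<or> u = a2"
    "\<And>u. adj b u \<longleftrightarrow> u = v \<or> u = b1 \<or> u = b2"
    "\<And>u. adj c u \<longleftrightarrow> u = v \<or> u = c1 \<or> u = c2"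
    "\<And>u. adj a1 u \<longleftrightarrow> u = a \<or> u = b1 \<or> u = c1"
    "\<And>u. adj a2 u \<longleftrightarrow> u = a \<or> u = b2 \<or> u = c2"
    "\<And>u. adj b1 u \<longleftrightarrow> u = b \<or> u = a1 \<or> u = c2"
    "\<And>u. adj b2 u \<longleftrightarrow> u = b \<or> u = a2 \<or> u = c1"
    "\<And>u. adj c1 u \<longleftrightarrow> u = c \<or> u = a1 \<or> u = b2"
    "\<And>u. adj c2 u \<longleftrightarrow> u = c \<or> u = a2 \<or> u = b1"
    using n[THEN adj_nbrs] by auto
  \<comment> \<open>This is a peeling order: \<open>a\<close> has neighbors of three colors, and
    each later vertex relies only on vertices peeled before.\<close>
  have a_safe: "safe ?S f a"
    by (rule safe3[OF n(2)]) (simp_all add: f)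
  have v_safe: "safe ?S f v"
    by (rule safe3[OF n(1)]) (simp_all add: f a_safe)
  have a1_safe: "safe ?S f a1"
    by (rule safe3[OF n(5)]) (simp_all add: f a_safe v_safe)
  have a2_safe: "safe ?S f a2"
    by (rule safe3[OF n(6)]) (simp_all add: f a_safe v_safe a1_safe)
  have c2_safe: "safe ?S f c2"
    by (rule safe3[OF n(10)]) (simp_all add: f a_safe v_safe a1_safe a2_safe)
  have b_safe: "safe ?S f b"
    by (rule safe3[OF n(3)]) (simp_all add: f a_safe v_safe a1_safe a2_safe c2_safe)
  have c1_safe: "safe ?S f c1"
    by (rule safe3[OF n(9)]) (simp_all add: f a_safe v_safe a1_safe a2_safe c2_safe b_safe)
  have b1_safe: "safe ?S f b1"
    by (rule safe3[OF n(7)]) (simp_all add: f a_safe v_safe a1_safe a2_safe c2_safe b_safe c1_safe)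
  have b2_safe: "safe ?S f b2"
    by (rule safe3[OF n(8)]) (simp_all add: f a_safe v_safe a1_safe a2_safe c2_safe b_safe c1_safe b1_safe)
  have c_safe: "safe ?S f c"
    by (rule safe3[OF n(4)]) (simp_all add: f a_safe v_safe a1_safe a2_safe c2_safe b_safe c1_safe
      b1_safe b2_safe)
  note safe = a_safe v_safe a1_safe a2_safe c2_safe b_safe c1_safe b1_safe b2_safe c_safe
  have "stuck ?S f v"
    using blocked_nbr[of v a ?S f 1] blocked_nbr[of v c ?S f 2]
      blocked_6_cycle[of v a a2 c2 b1 b ?S f 3] d by (auto intro!: stuckI simp: f adj)
  moreover have "stuck ?S f a1"
    using blocked_nbr[of a1 a ?S f 1] blocked_nbr[of a1 b1 ?S f 3]
      blocked_6_cycle[of a1 a v b b2 c1 ?S f 4] d by (auto intro!: stuckI simp: f adj)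
  moreover have "stuck ?S f a2"
    using blocked_nbr[of a2 a ?S f 1] blocked_nbr[of a2 b2 ?S f 4]
      blocked_6_cycle[of a2 a a1 c1 c c2 ?S f 2] d by (auto intro!: stuckI simp: f adj)
  moreover have "stuck ?S f a"
    by (rule stuck_rainbow[OF _ n(2)]) (simp_all add: f)
  moreover have "?S \<subseteq> V"
    using nbrs_subset[of v] nbrs_subset[of a] nbrs_subset[of b] nbrs_subset[of c] n by auto
  moreover have "proper_on G f ?S"
    using d by (auto simp: proper_on_def f adj)
  ultimately show ?thesis
    using safe f by (intro stuck_seed_inj[of ?S f "{}" a a1 a2 v]) auto
qed


section \<open>Seeds made of two prisms\<close>

definition prism_at ::
  "'a \<Rightarrow> 'a \<Rightarrow> 'a \<Rightarrow> 'a \<Rightarrow> 'a \<Rightarrow> 'a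
  \<Rightarrow> bool" where
  "prism_at x y z x' y' z' \<longleftrightarrow> nbrs x = {y, z, x'} \<and> nbrs y = {x, z, y'} \<and>
  nbrs z = {x, y, z'} \<and>
     nbrs x' = {x, y', z'} \<and> nbrs y' = {y, x', z'} \<and> nbrs z' = {z, x', y'} \<and> distinct
       [x, y, z, x', y', z']"

text \<open>No single prism can be stuck in all four colors, but two prisms share the work.\<close>
lemma prism_stuck:
  assumes P: "prism_at x y z x' y' z'" and S: "{x, y, z, x', y', z'} \<subseteq> S"
    and f: "f x = i" "f y = j" "f z = k" "f x' = j" "f y' = l" "f z' = i"
    and ijkl: "distinct [i, j, k, l]" "{1..4} = {i, j, k, l}"
  shows "s \<in> {x, y, z, x', y', z'} \<Longrightarrow> safe S f s" "stuck S f x" "stuck S f y"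
proof -
  have n: "nbrs x = {y, z, x'}" "nbrs y = {x, z, y'}" "nbrs z = {x, y, z'}"
     "nbrs x' = {x, y', z'}" "nbrs y' = {y, x', z'}" "nbrs z' = {z, x', y'}"
    and d: "distinct [x, y, z, x', y', z']"
    using P by (simp_all add: prism_at_def)
  have adj: "\<And>u. adj x u \<longleftrightarrow> u = y \<or> u = z \<or> u = x'"
    "\<And>u. adj y u \<longleftrightarrow> u = x \<or> u = z \<or> u = y'"
    "\<And>u. adj x' u \<longleftrightarrow> u = x \<or> u = y' \<or> u = z'"
    "\<And>u. adj y' u \<longleftrightarrow> u = y \<or> u = x' \<or> u = z'"
    using n[THEN adj_nbrs] by auto
  have "safe S f y"
    by (rule safe3[OF n(2)]) (use S ijkl in \<open>simp_all add: f\<close>)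
  moreover have "safe S f z'"
    by (rule safe3[OF n(6)]) (use S ijkl in \<open>simp_all add: f\<close>)
  moreover have "safe S f x"
    by (rule safe3[OF n(1)]) (use S ijkl \<open>safe S f y\<close> in \<open>simp_all add: f\<close>)
  moreover have "safe S f x'"
    by (rule safe3[OF n(4)]) (use S ijkl \<open>safe S f z'\<close> in \<open>simp_all add: f\<close>)
  moreover have "safe S f y'"
    by (rule safe3[OF n(5)]) (use S ijkl \<open>safe S f y\<close> in \<open>simp_all add: f\<close>)
  moreover have "safe S f z"
    by (rule safe3[OF n(3)]) (use S ijkl \<open>safe S f z'\<close> in \<open>simp_all add: f\<close>)
  ultimately show "s \<in> {x, y, z, x', y', z'} \<Longrightarrow> safe S f s"
    by auto
  have "j \<in> {1..4}"
    using ijkl(2) by simp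
  \<comment> \<open>Color \<open>l\<close> does not occur next to \<open>x\<close>; the 4-cycle
    \<open>x y y' x'\<close> blocks it, since \<open>y\<close> and \<open>x'\<close> share color
    \<open>j\<close>.\<close>
  then have "blocked S f x l"
    by (intro blocked_4_cycle[of x y y' x']) (use S d ijkl(1) in \<open>auto simp: f adj\<close>)
  moreover have "blocked S f x j" "blocked S f x k"
    using S blocked_nbr[of x y S f j] blocked_nbr[of x z S f k] by (simp_all add: f adj)
  ultimately show "stuck S f x"
    using S ijkl by (auto simp: stuck_def f)
  have "blocked S f y i" "blocked S f y k" "blocked S f y l"
    using S blocked_nbr[of y x S f i] blocked_nbr[of y z S f k] blocked_nbr[of y y' S f l]
    by (simp_all add: f adj)
  then show "stuck S f y"
    using S ijkl by (auto simp: stuck_def f)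
qed

lemma irreducible_two_prisms:
  assumes P: "prism_at x y z x' y' z'" and Q: "prism_at p q r p' q' r'"
    and d: "{x, y, z, x', y', z'} \<inter> {p, q, r, p', q', r'} = {}"
  shows "4 \<in> irreducible_color_numbers G"
proof -
  \<comment> \<open>The pattern \<open>i, j, k, l\<close> of a stuck prism is used as 1, 2, 3, 4 and
    as 3, 4, 1, 2: one prism holds colors 1 and 2, the other 3 and 4.\<close>
  define f where "f = (\<lambda>_. 0::nat)(x := 1, y := 2, z := 3, x' := 2, y' := 4, z' := 1,
    p := 3, q := 4, r := 1, p' := 4, q' := 2, r' := 3)"
  have dist: "distinct [x, y, z, x', y', z', p, q, r, p', q', r']"
    using P Q d by (auto simp: prism_at_def)
  have f: "f x = 1" "f y = 2" "f z = 3" "f x' = 2" "f y' = 4" "f z' = 1"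
    "f p = 3" "f q = 4" "f r = 1" "f p' = 4" "f q' = 2" "f r' = 3"
    using dist by (auto simp: f_def)
  let ?S = "{x, y, z, x', y', z', p, q, r, p', q', r'}"
  have P': "s \<in> {x, y, z, x', y', z'} \<Longrightarrow> safe ?S f s" "stuck ?S f x" "stuck ?S f y" for s
    by (rule prism_stuck[OF P _ f(1-6)]; force simp: nat_1_4)+
  have Q': "s \<in> {p, q, r, p', q', r'} \<Longrightarrow> safe ?S f s" "stuck ?S f p" "stuck ?S f q" for s
    by (rule prism_stuck[OF Q _ f(7-12)]; force simp: nat_1_4)+
  have "proper_on G f ?S"
  proof -
    have "f u \<noteq> f w" if "u \<in> ?S" "w \<in> nbrs u" for u w
    proof -
      have "u \<in> {x, y, z, x', y', z'} \<or> u \<in> {p, q, r, p', q', r'}" using that(1) by auto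
      then show ?thesis
        using that(2) P Q unfolding prism_at_def
        by (elim disjE insertE) (auto simp: f)
    qed
    then show ?thesis
      by (auto simp: proper_on_def nbrs_def)
  qed
  moreover have "?S \<subseteq> V"
    using P Q nbrs_subset[of x] nbrs_subset[of y] nbrs_subset[of x'] nbrs_subset[of p]
      nbrs_subset[of q] nbrs_subset[of p']
    unfolding prism_at_def by auto
  ultimately show ?thesis
    using P' Q' f by (intro stuck_seed_inj[of ?S f "{}" x y p q]) auto
qed

section \<open>Short cycles\<close>

lemma nbrs_eqI:
  assumes "adj v p" "adj v q" "adj v r" "p \<noteq> q" "p \<noteq> r" "q \<noteq> r"
  shows "nbrs v = {p, q, r}"
proof -
  have "{p, q, r} \<subseteq> nbrs v" "card {p, q, r} = card (nbrs v)"
    using assms card_nbrs[of v] adj_in_V(1)[of v p] by (auto simp: nbrs_def)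
  then show ?thesis
    using card_subset_eq[of "nbrs v" "{p, q, r}"] by simp
qed

text \<open>If \<open>p\<close> and \<open>q\<close> are adjacent, this is K4. Otherwise it is a
  diamond, and its seed depends on whether the third neighbors of \<open>p\<close> and
  \<open>q\<close> coincide.\<close>

lemma irreducible_double_triangle:
  assumes n: "nbrs x = {y, p, q}" "nbrs y = {x, p, q}" "p \<noteq> q"
  shows "4 \<in> irreducible_color_numbers G"
proof -
  have d: "x \<noteq> y" "x \<noteq> p" "x \<noteq> q" "y \<noteq> p" "y \<noteq> q"
    using nbrs_neq[OF n(1)] nbrs_neq[OF n(2)] by auto
  have "adj p x" "adj p y" "adj q x" "adj q y"
    using adj_nbrs[OF n(1)] adj_nbrs[OF n(2)] adj_sym by blast+
  then obtain p' q' where n': "nbrs p = {x, y, p'}" "nbrs q = {x, y, q'}" "x \<noteq> p'"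
    "y \<noteq> p'" "x \<noteq> q'" "y \<noteq> q'"
    using nbrs_cases2 d(1) by metis
  have pq: "p' \<noteq> p" "q' \<noteq> q"
    using nbrs_neq[OF n'(1)] nbrs_neq[OF n'(2)] by auto
  have eq: "p' = q \<longleftrightarrow> q' = p"
    using adj_nbrs[OF n'(1), of q] adj_nbrs[OF n'(2), of p] adj_commute[of p q] d by auto
  show ?thesis
  proof (cases "p' = q")
    case True
    then show ?thesis
      using irreducible_K4[of x y p q] n n' d eq by simp
  next
    case False
    show ?thesis
    proof (cases "p' = q'")
      case True
      then show ?thesis
        using irreducible_diamond_joined[of x y p q p'] n n' d pq False by auto
    next
      case neq: False
      then show ?thesis
        using irreducible_diamond_apart[of x y p q p' q'] n n' d pq False eq by auto
    qed
  qed
qed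

lemma irreducible_triangle:
  assumes "adj x y" "adj y z" "adj x z"
  shows "4 \<in> irreducible_color_numbers G \<or> (\<exists>x' y' z'. prism_at x y z x' y' z')"
proof -
  have d: "x \<noteq> y" "y \<noteq> z" "x \<noteq> z"
    using assms by auto
  obtain x' where x': "nbrs x = {y, z, x'}" "y \<noteq> x'" "z \<noteq> x'"
    using nbrs_cases2[OF assms(1,3) d(2)] .
  obtain y' where y': "nbrs y = {x, z, y'}" "x \<noteq> y'" "z \<noteq> y'"
    using nbrs_cases2[OF adj_sym[OF assms(1)] assms(2) d(3)] .
  obtain z' where z': "nbrs z = {x, y, z'}" "x \<noteq> z'" "y \<noteq> z'"
    using nbrs_cases2[OF adj_sym[OF assms(3)] adj_sym[OF assms(2)] d(1)] .
  have ne: "x \<noteq> x'" "y \<noteq> y'" "z \<noteq> z'"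
    using nbrs_neq[OF x'(1)] nbrs_neq[OF y'(1)] nbrs_neq[OF z'(1)] by auto
  consider (common) "x' = y' \<or> x' = z' \<or> y' = z'" | (apart) "distinct [x, y, z, x', y', z']"
    using d x' y' z' ne by auto
  then show ?thesis
  proof cases
    case common
    \<comment> \<open>Two triangle vertices with a common outer neighbor share both of their
      remaining neighbors.\<close>
    then have "4 \<in> irreducible_color_numbers G"
      using irreducible_double_triangle[of x y z x'] irreducible_double_triangle[of x z y x']
        irreducible_double_triangle[of y z x y'] x' y' z'
      by (auto simp: insert_commute)
    then show ?thesis ..
  next
    case apart
    have joined: "4 \<in> irreducible_color_numbers G"
      if n: "nbrs a = {b, c, a'}" "nbrs b = {a, c, b'}" "nbrs c = {a, b, c'}"
        and dist: "distinct [a, b, c, a', b', c']" and e: "adj a' b'" "\<not> adj b' c'"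
      for a b c a' b' c'
    proof -
      have "adj b' b" "adj b' a'"
        using adj_nbrs[OF n(2)] e adj_sym by blast+
      then obtain q where q: "nbrs b' = {b, a', q}" "b \<noteq> q" "a' \<noteq> q"
        using nbrs_cases2[of b' b a'] dist by auto
      have "adj q b'"
        using adj_nbrs[OF q(1)] adj_sym by blast
      then have "q \<noteq> a" "q \<noteq> c" "q \<noteq> c'" "q \<noteq> b'"
        using adj_nbrs[OF n(1)] adj_nbrs[OF n(3)] dist e(2) adj_sym by auto
      then show ?thesis
        using irreducible_triangle_joined[OF n q(1)] dist q by auto
    qed
    show ?thesis
    proof (cases "adj x' y' \<and> adj x' z' \<and> adj y' z'")
      case True
      then have "adj y' x'" "adj z' x'" "adj z' y'"
        using adj_sym by blast+
      moreover have "adj x' x" "adj y' y" "adj z' z"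
        using adj_nbrs[OF x'(1)] adj_nbrs[OF y'(1)] adj_nbrs[OF z'(1)] adj_sym by blast+
      ultimately have "nbrs x' = {x, y', z'}" "nbrs y' = {y, x', z'}" "nbrs z' = {z, x', y'}"
        using True apart nbrs_eqI[of x' x y' z'] nbrs_eqI[of y' y x' z'] nbrs_eqI[of z' z x' y'] by simp_all
      then have "prism_at x y z x' y' z'"
        using x' y' z' apart by (simp add: prism_at_def)
      then show ?thesis by blast
    next
      case False
      show ?thesis
      proof (cases "adj x' y' \<or> adj x' z' \<or> adj y' z'")
        case True
        \<comment> \<open>Some pair of outer neighbors is adjacent and some pair is not. Two pairs
          out of three vertices overlap in a vertex, which plays the role of \<open>b'\<close>; the
          six orders of the triangle cover every case.\<close>
        have p: "nbrs x = {z, y, x'}" "nbrs y = {z, x, y'}" "nbrs z = {y, x, z'}"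
          using x' y' z' by auto
        have dd: "distinct [x, y, z, x', y', z']" "distinct [x, z, y, x', z', y']"
          "distinct [y, x, z, y', x', z']"
          "distinct [y, z, x, y', z', x']" "distinct [z, x, y, z', x', y']" "distinct [z, y, x, z', y', x']"
          using apart by auto
        have "4 \<in> irreducible_color_numbers G"
          using True False adj_commute[of x' y'] adj_commute[of x' z'] adj_commute[of y' z']
            joined[OF x'(1) y'(1) z'(1) dd(1)] joined[OF p(1) z'(1) y'(1) dd(2)]
            joined[OF y'(1) x'(1) p(3) dd(3)] joined[OF p(2) p(3) x'(1) dd(4)]
            joined[OF z'(1) p(1) p(2) dd(5)] joined[OF p(3) p(2) p(1) dd(6)]
          by blast
        then show ?thesis ..
      next
        case no_edge: False
        have "adj x' x"
          using adj_nbrs[OF x'(1)] adj_sym by blast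
        then obtain p q where pq: "nbrs x' = {x, p, q}" "x \<noteq> p" "x \<noteq> q" "p \<noteq> q"
          using nbrs_cases1 by metis
        have "\<not> adj x' y" "\<not> adj x' z"
          using adj_sym[of x' y] adj_sym[of x' z] adj_nbrs[OF y'(1), of x'] adj_nbrs[OF z'(1), of x'] apart
          by auto
        then have "w \<noteq> y \<and> w \<noteq> z \<and> w \<noteq> y' \<and> w \<noteq> z' \<and> w
          \<noteq> x'"
          if "adj x' w" for w
          using that no_edge not_adj_self by blast
        from this[of p] this[of q] have "4 \<in> irreducible_color_numbers G"
          using irreducible_triangle_apart[OF x'(1) y'(1) z'(1) pq(1)] pq apart no_edge adj_nbrs[OF
            pq(1)] by auto
        then show ?thesis ..
      qed
    qed
  qed
qed

text \<open>Without triangles only outer neighbors of opposite vertices can coincide. Those opposite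
  vertices then have the same neighborhood, which gives K23; otherwise all eight vertices are
  distinct.\<close>

lemma irreducible_quadrilateral:
  assumes c: "adj v1 v2" "adj v2 v3" "adj v3 v4" "adj v4 v1" "v1 \<noteq> v3" "v2 \<noteq> v4"
    and no3: "\<And>x y z. \<lbrakk>x \<in> {v1, v2, v3, v4}; adj x y;
      adj y z; adj z x\<rbrakk> \<Longrightarrow> False"
  shows "4 \<in> irreducible_color_numbers G"
proof -
  note s = c(1-4)[THEN adj_sym]
  obtain w1 where w1: "nbrs v1 = {v2, v4, w1}" "v2 \<noteq> w1" "v4 \<noteq> w1"
    using nbrs_cases2[OF c(1) s(4) c(6)] .
  obtain w2 where w2: "nbrs v2 = {v1, v3, w2}" "v1 \<noteq> w2" "v3 \<noteq> w2"
    using nbrs_cases2[OF s(1) c(2) c(5)] .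
  obtain w3 where w3: "nbrs v3 = {v2, v4, w3}" "v2 \<noteq> w3" "v4 \<noteq> w3"
    using nbrs_cases2[OF s(2) c(3) c(6)] .
  obtain w4 where w4: "nbrs v4 = {v1, v3, w4}" "v1 \<noteq> w4" "v3 \<noteq> w4"
    using nbrs_cases2[OF c(4) s(3) c(5)] .
  have w: "adj v1 w1" "adj v2 w2" "adj v3 w3" "adj v4 w4"
    using adj_nbrs[OF w1(1)] adj_nbrs[OF w2(1)] adj_nbrs[OF w3(1)] adj_nbrs[OF w4(1)] by auto
  note ws = w[THEN adj_sym]
  have d: "v1 \<noteq> v2" "v2 \<noteq> v3" "v3 \<noteq> v4" "v4 \<noteq> v1" "v1 \<noteq> w1"
    "v2 \<noteq> w2" "v3 \<noteq> w3" "v4 \<noteq> w4"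
    using c w by auto
  have t: "w1 \<noteq> v3" "w3 \<noteq> v1" "w2 \<noteq> v4" "w4 \<noteq> v2" "w1 \<noteq> w2"
    "w2 \<noteq> w3" "w3 \<noteq> w4" "w4 \<noteq> w1"
    using no3[of v1 v2 v3] no3[of v2 v3 v4] no3[of v1 v2 w1] no3[of v2 v3 w2] no3[of v3 v4 w3] no3[of
      v4 v1 w4]
      c s w ws by auto
  show ?thesis
  proof (cases "w1 = w3 \<or> w2 = w4")
    case True
    then show ?thesis
      using irreducible_K23[of v1 v2 v4 w1 v3] irreducible_K23[of v2 v1 v3 w2 v4] w1 w2 w3 w4 c(5,6) d
        t by auto
  next
    case False
    then show ?thesis
      using irreducible_4_cycle[OF w1(1) w2(1) w3(1) w4(1)] w1 w2 w3 w4 c(5,6) d t by auto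
  qed
qed


section \<open>Girth at least five\<close>

definition ball_at :: "'a \<Rightarrow> 'a \<Rightarrow> 'a \<Rightarrow> 'a \<Rightarrow> 'a
  \<Rightarrow> 'a \<Rightarrow> 'a \<Rightarrow> 'a \<Rightarrow> 'a \<Rightarrow> 'a \<Rightarrow>
  bool" where
  "ball_at v a b c a1 a2 b1 b2 c1 c2 \<longleftrightarrow>
     nbrs v = {a, b, c} \<and> nbrs a = {v, a1, a2} \<and> nbrs b = {v, b1, b2} \<and> nbrs c = {v, c1,
       c2} \<and>
     distinct [v, a, b, c, a1, a2, b1, b2, c1, c2]"

text \<open>These exchanges generate all relabelings of the branches and of the leaves within a
  branch.\<close>

lemma ball_at_swap:
  assumes "ball_at v a b c a1 a2 b1 b2 c1 c2"
  shows "ball_at v a b c a2 a1 b1 b2 c1 c2" "ball_at v b a c b1 b2 a1 a2 c1 c2"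
    "ball_at v a c b a1 a2 c1 c2 b1 b2"
proof -
  have n: "nbrs v = {a, b, c}" "nbrs a = {v, a1, a2}" "nbrs b = {v, b1, b2}" "nbrs c = {v, c1, c2}"
    and d: "distinct [v, a, b, c, a1, a2, b1, b2, c1, c2]"
    using assms by (simp_all only: ball_at_def)
  have "nbrs a = {v, a2, a1}" "nbrs v = {b, a, c}" "nbrs v = {a, c, b}"
    by (simp_all only: n insert_commute)
  then show "ball_at v a b c a2 a1 b1 b2 c1 c2" "ball_at v b a c b1 b2 a1 a2 c1 c2"
    "ball_at v a c b a1 a2 c1 c2 b1 b2"
    using n d unfolding ball_at_def by (intro conjI; (assumption | force))+
qed

text \<open>
  Give \<open>a1\<close>, \<open>a2\<close> the colors 3, 2 and then color greedily first below
    \<open>c\<close>, then below \<open>b\<close>. The two choices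
  avoid the conflicts in colors 2 and 1; the one in color 3 would be an edge from \<open>a1\<close> to
    \<open>b1\<close> or \<open>b2\<close>.
\<close>
lemma irreducible_ball_greedy:
  assumes B: "ball_at v a b c a1 a2 b1 b2 c1 c2" and na: "\<not> adj a1 b1" "\<not> adj a1 b2"
    and no4: "\<And>x y z w. \<lbrakk>x \<in> {a1, a2, b1, b2, c1, c2}; adj x y;
      adj y z; adj z w; adj w x\<rbrakk> \<Longrightarrow> x = z \<or> y = w"
  shows "4 \<in> irreducible_color_numbers G"
proof -
  have n: "nbrs v = {a, b, c}" "nbrs a = {v, a2, a1}" "nbrs b = {v, b1, b2}" "nbrs c = {v, c1, c2}"
     "nbrs b = {v, b2, b1}" "nbrs c = {v, c2, c1}"
    and d: "distinct [v, a, b, c, a1, a2, b1, b2, c1, c2]"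
    using B by (simp_all add: ball_at_def insert_commute)
  have adj: "adj b b1" "adj b b2" "adj c c1" "adj c c2"
    using adj_nbrs[OF n(3)] adj_nbrs[OF n(4)] by auto
  \<comment> \<open>The leaves \<open>p\<close>, \<open>q\<close> of \<open>b\<close> receive colors
    1, 3, and the leaves \<open>r\<close>, \<open>s\<close> of \<open>c\<close> receive 2,
    1.\<close>
  have *: "4 \<in> irreducible_color_numbers G"
    if "(p, q) = (b1, b2) \<or> (p, q) = (b2, b1)" "(r, s) = (c1, c2) \<or> (r, s) = (c2, c1)"
      "\<not> adj a2 r" "\<not> adj p s" for p q r s
  proof (rule irreducible_rainbow_ball)
    show "nbrs v = {a, b, c}" "nbrs a = {v, a2, a1}" "nbrs b = {v, p, q}" "nbrs c = {v, r, s}"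
      using n that by auto
    show "distinct [v, a, b, c, a2, a1, p, q, r, s]"
      using d that by auto
    show "\<not> adj a1 q" "\<not> adj a2 r" "\<not> adj p s"
      using na that by auto
    fix x y z w assume "{x, y, z, w} \<subseteq> {a2, a1, p, q, r, s}" "adj x y" "adj y z" "adj z w"
      "adj w x"
    then show "x = z \<or> y = w"
      using that(1,2) by (intro no4) auto
  qed
  \<comment> \<open>A leaf adjacent to both leaves of another branch would close a 4-cycle. So some
    \<open>r\<close> is not adjacent to \<open>a2\<close>, and for the remaining \<open>s\<close>
    some \<open>p\<close> is not adjacent to \<open>s\<close>.\<close>
  have b: "\<not> adj b1 s \<or> \<not> adj b2 s" if "s \<in> {c1, c2}" for s
    using no4[of s b1 b b2] that adj d adj_sym by auto
  have c: "\<not> adj a2 c1 \<or> \<not> adj a2 c2"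
    using no4[of a2 c1 c c2] adj d adj_sym by auto
  show ?thesis
    using c b[of c1] b[of c2] *[of b1 b2 c1 c2] *[of b2 b1 c1 c2] *[of b1 b2 c2 c1] *[of b2 b1 c2 c1]
      by auto
qed

text \<open>If the greedy coloring fails under every relabeling, each leaf has a neighbor in both
  other branches. Without triangles and 4-cycles the leaves can then be joined in only one way, that
  of the Petersen graph.\<close>

lemma irreducible_ball:
  assumes B: "ball_at v a b c a1 a2 b1 b2 c1 c2"
    and no3: "\<And>x y z. \<lbrakk>x \<in> {a1, a2, b1, b2, c1, c2}; adj x y;
      adj y z; adj z x\<rbrakk> \<Longrightarrow> False"
    and no4: "\<And>x y z w. \<lbrakk>x \<in> {a1, a2, b1, b2, c1, c2}; adj x y;
      adj y z; adj z w; adj w x\<rbrakk> \<Longrightarrow> x = z \<or> y = w"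
  shows "4 \<in> irreducible_color_numbers G"
proof (rule ccontr)
  assume no: "4 \<notin> irreducible_color_numbers G"
  define L where "L = {a1, a2, b1, b2, c1, c2}"
  \<comment> \<open>Recording the leaf set \<open>L\<close> makes \<open>no3\<close> and
    \<open>no4\<close> available after any relabeling.\<close>
  define ball where "ball a b c a1 a2 b1 b2 c1 c2 \<longleftrightarrow>
    ball_at v a b c a1 a2 b1 b2 c1 c2 \<and> {a1, a2, b1, b2, c1, c2} = L" for a b c a1 a2 b1 b2 c1 c2
  have L: "x \<in> L \<longleftrightarrow> x = a1 \<or> x = a2 \<or> x = b1 \<or> x = b2 \<or> x = c1
    \<or> x = c2"
    if "ball a b c a1 a2 b1 b2 c1 c2" for a b c a1 a2 b1 b2 c1 c2 x
  proof -
    have "L = {a1, a2, b1, b2, c1, c2}"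
      using that by (simp add: ball_def)
    then show ?thesis by (simp only: insert_iff empty_iff simp_thms)
  qed
  have swap: "ball a b c a2 a1 b1 b2 c1 c2" "ball b a c b1 b2 a1 a2 c1 c2" "ball a c b a1 a2 c1 c2 b1 b2"
    if "ball a b c a1 a2 b1 b2 c1 c2" for a b c a1 a2 b1 b2 c1 c2
    using that ball_at_swap[of v a b c a1 a2 b1 b2 c1 c2] by (simp_all add: ball_def insert_commute)
  have swap_b: "ball a b c a1 a2 b2 b1 c1 c2" if "ball a b c a1 a2 b1 b2 c1 c2" for a b c a1 a2 b1 b2 c1 c2
    using swap(2)[OF swap(1)[OF swap(2)[OF that]]] .
  have swap_c: "ball a b c a1 a2 b1 b2 c2 c1" if "ball a b c a1 a2 b1 b2 c1 c2" for a b c a1 a2 b1 b2 c1 c2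
    using swap(3)[OF swap_b[OF swap(3)[OF that]]] .
  have ab: "adj a1 b1 \<or> adj a1 b2" if "ball a b c a1 a2 b1 b2 c1 c2" for a b c a1 a2 b1 b2 c1 c2
  proof (rule ccontr)
    assume "\<not> ?thesis"
    moreover have "ball_at v a b c a1 a2 b1 b2 c1 c2"
      using that by (simp add: ball_def)
    ultimately have "4 \<in> irreducible_color_numbers G"
      using irreducible_ball_greedy no4[folded L_def, unfolded L[OF that]] by auto
    with no show False ..
  qed
  have perfect: "adj a1 b1 \<or> adj a1 b2" "adj a1 c1 \<or> adj a1 c2" "adj b1 c1 \<or> adj b1 c2"
    if B: "ball a b c a1 a2 b1 b2 c1 c2" for a b c a1 a2 b1 b2 c1 c2
    using ab[OF B] ab[OF swap(3)[OF B]] ab[OF swap(3)[OF swap(2)[OF B]]] .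
  have B0: "ball a b c a1 a2 b1 b2 c1 c2"
    using B by (simp add: ball_def L_def)
  obtain b1 b2 where B1: "ball a b c a1 a2 b1 b2 c1 c2" "adj a1 b1"
    using perfect(1)[OF B0] B0 swap_b[OF B0] by blast
  obtain c1 c2 where B2: "ball a b c a1 a2 b1 b2 c1 c2" "adj a1 c1"
    using perfect(2)[OF B1(1)] B1(1) swap_c[OF B1(1)] by blast
  have n: "nbrs v = {a, b, c}" "nbrs a = {v, a1, a2}" "nbrs b = {v, b1, b2}" "nbrs c = {v, c1, c2}"
    and d: "distinct [v, a, b, c, a1, a2, b1, b2, c1, c2]"
    using B2(1) by (simp_all only: ball_def ball_at_def)
  note no3 = no3[folded L_def, unfolded L[OF B2(1)]]
  note no4 = no4[folded L_def, unfolded L[OF B2(1)]]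
  have up: "adj a1 a" "adj a2 a" "adj b1 b" "adj b2 b" "adj c1 c" "adj c2 c"
    using adj_nbrs[OF n(2)] adj_nbrs[OF n(3)] adj_nbrs[OF n(4)] adj_sym by blast+
  note down = up[THEN adj_sym]
  note B2' = swap(1)[OF B2(1)]
  \<comment> \<open>A common leaf neighbor of \<open>a1\<close> and \<open>a2\<close> would close a
    4-cycle with \<open>a\<close>, so \<open>a2\<close> takes the other leaf in each branch. The
    remaining two edges are forced because triangles are excluded.\<close>
  have a2: "adj a2 b2" "adj a2 c2"
    using perfect(1,2)[OF B2'] no4[of a2 b1 a1 a] no4[of a2 c1 a1 a] up down d
      adj_sym[OF B1(2)] adj_sym[OF B2(2)] by auto
  have b1: "adj b1 c2"
    using perfect(3)[OF B2(1)] no3[of a1 b1 c1] B1(2) adj_sym[OF B2(2)] by auto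
  have b2: "adj b2 c1"
    using perfect(3)[OF swap_b[OF B2(1)]] no3[of a2 b2 c2] a2(1) adj_sym[OF a2(2)] by auto
  note e = B1(2) B2(2) a2 b1 b2
  note e' = e[THEN adj_sym]
  have "4 \<in> irreducible_color_numbers G"
  proof (rule irreducible_Petersen[OF n _ _ _ _ _ _ d])
    show "nbrs a1 = {a, b1, c1}" "nbrs a2 = {a, b2, c2}" "nbrs b1 = {b, a1, c2}"
      "nbrs b2 = {b, a2, c1}" "nbrs c1 = {c, a1, b2}" "nbrs c2 = {c, a2, b1}"
      by (rule nbrs_eqI; use e e' up d in simp)+
  qed
  with no show False ..
qed

text \<open>Working in a set \<open>W\<close> closed under adjacency permits short cycles in other
  components. Inside \<open>W\<close>, the ten vertices at distance at most 2 from \<open>v\<close>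
  are distinct.\<close>

lemma irreducible_girth_5:
  assumes "v \<in> W" "W \<subseteq> V" and closed:
    "\<And>u w. \<lbrakk>u \<in> W; adj u w\<rbrakk> \<Longrightarrow> w \<in> W"
    and no3: "\<And>x y z. \<lbrakk>x \<in> W; adj x y; adj y z; adj z x\<rbrakk> \<Longrightarrow> False"
    and no4: "\<And>x y z w. \<lbrakk>x \<in> W; adj x y;
      adj y z; adj z w; adj w x\<rbrakk> \<Longrightarrow> x = z \<or> y = w"
  shows "4 \<in> irreducible_color_numbers G"
proof -
  obtain a b c where v: "nbrs v = {a, b, c}" "a \<noteq> b" "a \<noteq> c" "b \<noteq> c"
    using nbrs_cases[OF subsetD[OF assms(2,1)]] .
  then have av: "adj v a" "adj v b" "adj v c"
    using adj_nbrs[OF v(1)] by auto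
  note va = av[THEN adj_sym]
  obtain a1 a2 where a: "nbrs a = {v, a1, a2}" "v \<noteq> a1" "v \<noteq> a2" "a1 \<noteq> a2"
    using nbrs_cases1[OF va(1)] .
  obtain b1 b2 where b: "nbrs b = {v, b1, b2}" "v \<noteq> b1" "v \<noteq> b2" "b1 \<noteq> b2"
    using nbrs_cases1[OF va(2)] .
  obtain c1 c2 where c: "nbrs c = {v, c1, c2}" "v \<noteq> c1" "v \<noteq> c2" "c1 \<noteq> c2"
    using nbrs_cases1[OF va(3)] .
  have down: "adj a a1" "adj a a2" "adj b b1" "adj b b2" "adj c c1" "adj c c2"
    using adj_nbrs[OF a(1)] adj_nbrs[OF b(1)] adj_nbrs[OF c(1)] by auto
  note up = down[THEN adj_sym]
  have W: "a \<in> W" "b \<in> W" "c \<in> W"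
    using closed assms(1) av by blast+
  then have W': "{a1, a2, b1, b2, c1, c2} \<subseteq> W"
    using closed down by blast
  have n3: "\<not> adj p q" if "adj v p" "adj v q" for p q
    using no3[OF assms(1) that(1) _ adj_sym[OF that(2)]] by blast
  have n4: "x \<noteq> y" if "adj v p" "adj v q" "p \<noteq> q" "adj p x" "adj q y"
    "x \<noteq> v" for p q x y
  proof
    assume "x = y"
    then have "adj x q" "adj q v"
      using that adj_sym by blast+
    from no4[OF assms(1) that(1,4) this] show False
      using that(3,6) by auto
  qed
  have "\<not> adj a b" "\<not> adj a c" "\<not> adj b a" "\<not> adj b c" "\<not> adj c a" "\<not> adj c b"
    by (rule n3; fact av)+
  then have l1: "a1 \<noteq> b" "a1 \<noteq> c" "a2 \<noteq> b" "a2 \<noteq> c" "b1 \<noteq> a"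
    "b1 \<noteq> c" "b2 \<noteq> a" "b2 \<noteq> c"
    "c1 \<noteq> a" "c1 \<noteq> b" "c2 \<noteq> a" "c2 \<noteq> b" "a \<noteq> a1" "a \<noteq> a2"
    "b \<noteq> b1" "b \<noteq> b2" "c \<noteq> c1" "c \<noteq> c2"
    using down by auto
  have l2: "x \<noteq> y" if "adj a x" "x \<noteq> v" "adj b y \<or> adj c y" for x y
    using that n4[OF av(1,2) v(2), of x y] n4[OF av(1,3) v(3), of x y] by blast
  have "x \<noteq> y" if "x \<in> {a1, a2}" "y \<in> {b1, b2, c1, c2}" for x y
    by (rule l2) (use that down a in auto)
  then have l2: "{a1, a2} \<inter> {b1, b2, c1, c2} = {}"
    by blast
  have "x \<noteq> y" if "x \<in> {b1, b2}" "y \<in> {c1, c2}" for x y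
    by (rule n4[OF av(2,3) v(4)]) (use that down b in auto)
  then have l3: "{b1, b2} \<inter> {c1, c2} = {}"
    by blast
  have "v \<noteq> a" "v \<noteq> b" "v \<noteq> c"
    using av by auto
  then have "distinct [v, a, b, c, a1, a2, b1, b2, c1, c2]"
    using v a b c l1 l2 l3 by auto
  then have "ball_at v a b c a1 a2 b1 b2 c1 c2"
    using v(1) a(1) b(1) c(1) by (simp only: ball_at_def simp_thms)
  then show ?thesis
    by (rule irreducible_ball) (use no3 no4 subsetD[OF W'] in blast)+
qed

end

section \<open>The prism\<close>

lemma pverts_prism: "pverts prism = {1, 2} \<times> {1, 2, 3}"
proof -
  have "{1..2} = {1, 2::nat}" "{1..3} = {1, 2, 3::nat}"
    by auto
  then show ?thesis
    unfolding cartesian_product_def complete_graph_def by simp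
qed

lemma parcs_prism: "((i, j), (i', j')) \<in> parcs prism \<longleftrightarrow> (i, j) \<in> pverts
  prism \<and> (i', j') \<in> pverts prism \<and>
    (i = i' \<and> j \<noteq> j' \<or> i \<noteq> i' \<and> j = j')"
  unfolding cartesian_product_def complete_graph_def by auto

lemma pair_graph_prism: "pair_graph prism"
proof -
  have "pair_graph (complete_graph n)" for n
  proof
    show "finite (parcs (complete_graph n))"
      by (rule finite_subset[of _ "{1..n} \<times> {1..n}"]) (auto simp: complete_graph_def)
  qed (auto simp: complete_graph_def symmetric_def sym_def)
  then show ?thesis
    by (intro pair_graph_cartesian_product)
qed

text \<open>
  For a proper coloring of the prism, the only possible bicolored cycles are the three 4-cycles
  through both triangles.
\<close>
definition crossed :: "(nat \<times> nat \<Rightarrow> nat) \<Rightarrow> nat \<Rightarrow> nat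
  \<Rightarrow> bool" where
  "crossed c j j' \<longleftrightarrow> c (1, j) = c (2, j') \<and> c (1, j') = c (2, j)"

text \<open>Equally colored neighbors \<open>y\<close>, \<open>z\<close> of \<open>x\<close> do not
  both lie in the triangle of \<open>x\<close>, so one of them is in the other triangle. Following
  the core through the one in the same triangle leads to the vertex diagonal to \<open>x\<close>,
  and two columns are crossed.\<close>

lemma prism_no_core:
  assumes proper: "proper_on prism c (pverts prism)"
    and uncrossed: "\<And>j j'. \<lbrakk>j \<in> {1, 2, 3}; j' \<in> {1, 2, 3}; j \<noteq> j'\<rbrakk>
      \<Longrightarrow> \<not> crossed c j j'"
    and X: "X \<subseteq> pverts prism"
  shows "\<not> core prism c X"
proof
  assume "core prism c X"
  then obtain x y z x' x'' where x: "x \<in> X" "y \<in> X" "z \<in> X" "x' \<in> X" "x'' \<in> X"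
    "(x, y) \<in> parcs prism" "(x, z) \<in> parcs prism" "y \<noteq> z" "c y = c z"
    "(y, x') \<in> parcs prism" "x' \<noteq> x" "c x' = c x" "(z, x'') \<in> parcs prism"
    "x'' \<noteq> x" "c x'' = c x"
    by (rule core_path[OF _ proper_on_subset[OF proper X]])
  have na: "(u, w) \<notin> parcs prism" if "u \<in> X" "w \<in> X" "c u = c w" for u w
    using proper_onD[OF proper] that X by blast
  have n: "(y, z) \<notin> parcs prism" "(x, x') \<notin> parcs prism" "(x, x'') \<notin> parcs prism"
    using na x by auto
  have *: False
    if h: "(x, y) \<in> parcs prism" "(x, z) \<in> parcs prism" "c y = c z"
      "(y, x') \<in> parcs prism" "x' \<noteq> x" "c x' = c x"
      "(x, x') \<notin> parcs prism" "fst y = fst x" "fst z \<noteq> fst x" for x y z x'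
  proof -
    obtain i j where xij: "x = (i, j)" by fastforce
    obtain j1 where y: "y = (i, j1)" using h(8) xij by (cases y) auto
    obtain i' where z: "z = (i', j)" "i' \<noteq> i"
      using h(2,9) xij by (cases z) (auto simp: parcs_prism)
    have ij: "i \<in> {1, 2}" "i' \<in> {1, 2}" "j \<in> {1, 2, 3}" "j1 \<in> {1, 2, 3}" "j \<noteq> j1"
      using h(1,2) unfolding xij y z parcs_prism pverts_prism by auto
    have "x' = (i', j1)"
      using h(4,5,7) z ij unfolding xij y by (cases x') (auto simp: parcs_prism pverts_prism)
    then have "c (i, j) = c (i', j1)" "c (i, j1) = c (i', j)"
      using h xij y z by auto
    then have "crossed c j j1"
      using ij z(2) by (auto simp: crossed_def)
    with uncrossed ij show False by blast
  qed
  have "fst y = fst x \<and> fst z \<noteq> fst x \<or> fst z = fst x \<and> fst y \<noteq> fst x"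
    using x(6-8) n(1) X x(1-3)
    by (cases x; cases y; cases z) (auto simp: parcs_prism pverts_prism)
  then show False
    using *[of x y z x'] *[of x z y x''] x n by metis
qed

lemma acyclic_coloring_prismI:
  assumes "c ` pverts prism \<subseteq> C" "proper_on prism c (pverts prism)"
    and "\<And>j j'. \<lbrakk>j \<in> {1, 2, 3}; j' \<in> {1, 2, 3}; j \<noteq> j'\<rbrakk>
      \<Longrightarrow> \<not> crossed c j j'"
  shows "acyclic_coloring prism C c"
  by (rule acyclic_coloringI[OF pair_graph_prism assms(1,2) prism_no_core[OF assms(2,3)]])

lemma acyclic_coloring_prismD:
  assumes "acyclic_coloring prism C c"
  shows "proper_on prism c (pverts prism)"
    "\<And>j j'. \<lbrakk>j \<in> {1, 2, 3}; j' \<in> {1, 2, 3}; j \<noteq> j'\<rbrakk>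
    \<Longrightarrow> \<not> crossed c j j'"
proof -
  have col: "c ` pverts prism \<subseteq> C" "\<forall>(u, v)\<in>parcs prism. c u \<noteq> c v"
    using assms unfolding acyclic_coloring_def coloring_def by blast+
  then show "proper_on prism c (pverts prism)"
    unfolding proper_on_def by blast
  fix j j' :: nat assume j: "j \<in> {1, 2, 3}" "j' \<in> {1, 2, 3}" "j \<noteq> j'"
  show "\<not> crossed c j j'"
  proof
    assume cr: "crossed c j j'"
    have V: "(1, j) \<in> pverts prism" "(1, j') \<in> pverts prism" "(2, j) \<in> pverts prism"
      "(2, j') \<in> pverts prism"
      using j unfolding pverts_prism by auto
    have "cyclic_list prism [(1, j), (1, j'), (2, j'), (2, j)]"
      using V j(3) by (simp add: cyclic_list_def parcs_prism)
    moreover have "c ` set [(1, j), (1, j'), (2, j'), (2, j)] \<subseteq> {c (1, j), c (1, j')}"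
      using cr by (auto simp: crossed_def)
    moreover have "c (1, j) \<in> C" "c (1, j') \<in> C"
      using V col(1) by blast+
    moreover have "set [(1, j), (1, j'), (2, j'), (2, j)] \<subseteq> pverts prism"
      using V by simp
    ultimately show False
      using acyclic_coloring_cyclic_list[OF assms] by blast
  qed
qed

section \<open>The acyclic b-chromatic number of the prism\<close>

lemma three_irreducible_prism: "3 \<in> irreducible_color_numbers prism"
proof -
  \<comment> \<open>The second triangle carries the colors of the first shifted cyclically, which
    crosses no two columns.\<close>
  define c :: "nat \<times> nat \<Rightarrow> nat" where
    "c = (\<lambda>_. 0)((1, 1) := 1, (1, 2) := 2, (1, 3) := 3, (2, 1) := 2, (2, 2) := 3, (2, 3) := 1)"
  have c: "c (1, 1) = 1" "c (1, 2) = 2" "c (1, 3) = 3" "c (2, 1) = 2" "c (2, 2) = 3" "c (2, 3) = 1"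
    by (simp_all add: c_def)
  have "{1..3} = {1, 2, 3::nat}" by auto
  then have im: "c ` pverts prism = {1..3}"
    unfolding pverts_prism by (auto simp: insert_Times_insert c simp flip: One_nat_def)
  have "proper_on prism c (pverts prism)"
    unfolding proper_on_def pverts_prism by (simp add: parcs_prism insert_Times_insert c flip: One_nat_def)
  then have "acyclic_coloring prism {1..3} c"
    by (rule acyclic_coloring_prismI[rotated]) (use im in \<open>auto simp: crossed_def c simp flip:
      One_nat_def\<close>)
  moreover have "\<not> acyclic_recoloring_possible prism 3 c"
  proof
    assume "acyclic_recoloring_possible prism 3 c"
    then obtain i c' where i: "i \<in> {1..3}" and "acyclic_coloring prism ({1..3} - {i}) c'"
      unfolding acyclic_recoloring_possible_def by blast
    then have c': "c' ` pverts prism \<subseteq> {1..3} - {i}"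
      "\<forall>(u, v)\<in>parcs prism. c' u \<noteq> c' v"
      unfolding acyclic_coloring_def coloring_def by blast+
    \<comment> \<open>A step would leave two colors for a triangle.\<close>
    have arcs: "((1, 1), (1, 2)) \<in> parcs prism" "((1, 1), (1, 3)) \<in> parcs prism"
      "((1, 2), (1, 3)) \<in> parcs prism"
      by (simp_all add: parcs_prism pverts_prism)
    have "card {c' (1, 1), c' (1, 2), c' (1, 3)} = 3"
    proof -
      have "c' (1, 1) \<noteq> c' (1, 2)" "c' (1, 1) \<noteq> c' (1, 3)" "c' (1, 2) \<noteq> c' (1, 3)"
        using c'(2) arcs by blast+
      then show ?thesis by simp
    qed
    moreover have "{c' (1, 1), c' (1, 2), c' (1, 3)} \<subseteq> {1..3} - {i}"
      using c'(1) unfolding pverts_prism by auto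
    then have "card {c' (1, 1), c' (1, 2), c' (1, 3)} \<le> card ({1..3} - {i})"
      by (rule card_mono[rotated]) simp
    ultimately show False
      using i by simp
  qed
  ultimately show ?thesis
    using im by (auto simp: irreducible_color_numbers_def)
qed

text \<open>
  Pairs of equally colored vertices form a partial matching of the 6-cycle complementary to the
  prism; without crossings and with at least four colors it can be enlarged.
\<close>
lemma merge_colors:
  fixes x1 x2 x3 y1 y2 y3 :: nat
  assumes "distinct [x1, x2, x3]" "distinct [y1, y2, y3]" "x1 \<noteq> y1" "x2 \<noteq> y2" "x3 \<noteq> y3"
    "\<not> (x1 = y2 \<and> x2 = y1)" "\<not> (x1 = y3 \<and> x3 = y1)" "\<not> (x2 = y3 \<and> x3 = y2)"
    "4 \<le> card {x1, x2, x3, y1, y2, y3}"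
  defines "free \<equiv> \<lambda>x y x' y'. x \<notin> {y1, y2, y3} \<and> y \<notin> {x1, x2, x3}
    \<and> x' \<noteq> y'"
  shows "free x1 y2 x2 y1 \<or> free x2 y1 x1 y2 \<or> free x1 y3 x3 y1 \<or> free x3 y1 x1 y3 \<or>
    free x2 y3 x3 y2 \<or> free x3 y2 x2 y3"
proof -
  \<comment> \<open>The first triangle carries only three colors, so a fourth one appears in the
    second.\<close>
  have "\<not> {y1, y2, y3} \<subseteq> {x1, x2, x3}"
  proof
    assume "{y1, y2, y3} \<subseteq> {x1, x2, x3}"
    then have "{x1, x2, x3, y1, y2, y3} = {x1, x2, x3}" by auto
    then show False using assms(9) assms(1) by simp
  qed
  then show ?thesis
    using assms(1-8) unfolding free_def by (simp, smt (verit))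
qed

text \<open>With at least four colors, two nonadjacent vertices that are each alone in their class
  can be given the same color without crossing columns, and this is a recoloring step.\<close>

lemma irreducible_prism_le_3:
  assumes "k \<in> irreducible_color_numbers prism"
  shows "k \<le> 3"
proof (rule ccontr)
  assume "\<not> k \<le> 3"
  obtain c where acyc: "acyclic_coloring prism {1..k} c" and im: "c ` pverts prism = {1..k}"
    and irred: "\<not> acyclic_recoloring_possible prism k c"
    using assms by (auto simp: irreducible_color_numbers_def)
  note proper = acyclic_coloring_prismD(1)[OF acyc] and uncrossed = acyclic_coloring_prismD(2)[OF acyc]
  have V: "(i, j) \<in> pverts prism" if "i \<in> {1, 2}" "j \<in> {1, 2, 3}" for i j
    using that unfolding pverts_prism by auto
  have row: "c (i, j) \<noteq> c (i, j')" if "i \<in> {1, 2}" "j \<in> {1, 2, 3}" "j' \<in> {1, 2, 3}"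
    "j \<noteq> j'" for i j j'
    using proper_onD[OF proper V[OF that(1,2)] V[OF that(1,3)]] that by (simp add: parcs_prism V)
  have column: "c (1, j) \<noteq> c (2, j)" if "j \<in> {1, 2, 3}" for j
    using proper_onD[OF proper V[OF _ that] V[OF _ that]] that by (simp add: parcs_prism V)
  \<comment> \<open>By the first two conditions in \<open>new\<close>, the vertices
    \<open>(1, j)\<close> and \<open>(2, j')\<close> are alone in their classes; the third one
    prevents their columns from becoming crossed.\<close>
  have merge: False
    if j: "j \<in> {1, 2, 3}" "j' \<in> {1, 2, 3}" "j \<noteq> j'"
      and new: "c (1, j) \<notin> {c (2, 1), c (2, 2), c (2, 3)}"
        "c (2, j') \<notin> {c (1, 1), c (1, 2), c (1, 3)}"
        "c (1, j') \<noteq> c (2, j)" for j j'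
  proof -
    let ?c = "\<lambda>v. if c v = c (1, j) then c (2, j') else c v"
    have u: "v = (1, j)" if "v \<in> pverts prism" "c v = c (1, j)" for v
    proof -
      from that(1) obtain i d where v: "v = (i, d)" "i = 1 \<or> i = 2" "d \<in> {1, 2, 3}"
        unfolding pverts_prism by blast
      then have "i = 1"
        using that(2) new(1) by auto
      then show ?thesis
        using that(2) row[of 1 d j] v j(1) by auto
    qed
    have w: "v = (2, j')" if "v \<in> pverts prism" "c v = c (2, j')" for v
    proof -
      from that(1) obtain i d where v: "v = (i, d)" "i = 1 \<or> i = 2" "d \<in> {1, 2, 3}"
        unfolding pverts_prism by blast
      then have "i = 2"
        using that(2) new(2) by auto
      then show ?thesis
        using that(2) row[of 2 d j'] v j(2) by auto
    qed
    have eq: "?c v = (if v = (1, j) then c (2, j') else c v)" if "v \<in> pverts prism" for v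
      using u[OF that] by auto
    have range: "c (2, j') \<in> {1..k} - {c (1, j)}" "c (1, j) \<in> {1..k}"
      using im V[of 2 j'] V[of 1 j] j new(2) by auto
    have nonadj: "((1, j), (2, j')) \<notin> parcs prism" "((2, j'), (1, j)) \<notin> parcs prism"
      using j(3) by (auto simp: parcs_prism)
    have "acyclic_coloring prism ({1..k} - {c (1, j)}) ?c"
    proof (rule acyclic_coloring_prismI)
      show "?c ` pverts prism \<subseteq> {1..k} - {c (1, j)}"
        using range im by auto
      show "proper_on prism ?c (pverts prism)"
        unfolding proper_on_def
      proof (intro ballI impI)
        fix v x assume vx: "v \<in> pverts prism" "x \<in> pverts prism" "(v, x) \<in> parcs prism"
        have "c v \<noteq> c x"
          using proper_onD[OF proper vx] .
        moreover have "c x \<noteq> c (2, j')" if "c v = c (1, j)"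
          using u[OF vx(1) that] w[OF vx(2)] vx(3) nonadj by auto
        moreover have "c v \<noteq> c (2, j')" if "c x = c (1, j)"
          using u[OF vx(2) that] w[OF vx(1)] vx(3) nonadj by auto
        ultimately show "?c v \<noteq> ?c x"
          by auto
      qed
      fix a b :: nat assume ab: "a \<in> {1, 2, 3}" "b \<in> {1, 2, 3}" "a \<noteq> b"
      show "\<not> crossed ?c a b"
      proof
        assume "crossed ?c a b"
        then have *: "?c (1, a) = ?c (2, b)" "?c (1, b) = ?c (2, a)"
          by (simp_all only: crossed_def)
        have e: "?c (2, d) = c (2, d)" "?c (1, d) = (if d = j then c (2, j') else c (1, d))" if
          "d \<in> {1, 2, 3}" for d
          using eq[OF V[of 2 d]] eq[OF V[of 1 d]] that by simp_all
        note * = *[unfolded e[OF ab(1)] e[OF ab(2)]]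
        \<comment> \<open>A new crossing involves the recolored vertex \<open>(1, j)\<close>, hence
          its only partner in color \<open>(2, j')\<close>, and the third condition in
          \<open>new\<close> excludes it.\<close>
        consider "a \<noteq> j" "b \<noteq> j" | "a = j" "b \<noteq> j" | "a \<noteq> j" "b = j"
          using ab(3) by blast
        then show False
        proof cases
          case 1
          then show ?thesis
            using * uncrossed[OF ab] by (simp add: crossed_def)
        next
          case 2
          then have "b = j'"
            using *(1) row[of 2 j' b] ab(2) j(2) by auto
          then show ?thesis
            using *(2) 2 new(3) by simp
        next
          case 3
          then have "a = j'"
            using *(2) row[of 2 j' a] ab(1) j(2) by auto
          then show ?thesis
            using *(1) 3 new(3) by simp
        qed
      qed
    qed
    moreover have "c (2, j') \<in> {1..k} - {c (1, j)} \<and> c (2, j') \<notin> c `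
      closed_neighborhood prism v"
      if "v \<in> color_class prism c (c (1, j))" for v
    proof -
      have "v = (1, j)"
        using that u by (auto simp: color_class_def)
      moreover have "c (2, j') \<noteq> c x" if "((1, j), x) \<in> parcs prism" for x
      proof
        assume "c (2, j') = c x"
        moreover have "x \<in> pverts prism"
          using that by (cases x) (simp add: parcs_prism)
        ultimately have "x = (2, j')"
          using w by metis
        with that nonadj show False by simp
      qed
      ultimately show ?thesis
        using range unfolding closed_neighborhood_def by auto
    qed
    ultimately have "acyclic_recoloring_possible prism k c"
      unfolding acyclic_recoloring_possible_def using range(2)
      by (intro bexI[of _ "c (1, j)"] exI[of _ "\<lambda>_. c (2, j')"]) blast+
    with irred show False ..
  qed
  have six: "c ` pverts prism = {c (1, 1), c (1, 2), c (1, 3), c (2, 1), c (2, 2), c (2, 3)}"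
    unfolding pverts_prism by auto
  have "card {c (1, 1), c (1, 2), c (1, 3), c (2, 1), c (2, 2), c (2, 3)} = k"
    unfolding six[symmetric] im by simp
  then have "4 \<le> card {c (1, 1), c (1, 2), c (1, 3), c (2, 1), c (2, 2), c (2, 3)}"
    using \<open>\<not> k \<le> 3\<close> by simp
  from merge_colors[OF _ _ _ _ _ _ _ _ this] show False
    using row[of 1 1 2] row[of 1 1 3] row[of 1 2 3] row[of 2 1 2] row[of 2 1 3] row[of 2 2 3]
      column[of 1] column[of 2] column[of 3] uncrossed[of 1 2] uncrossed[of 1 3] uncrossed[of 2 3]
      merge[of 1 2] merge[of 2 1] merge[of 1 3] merge[of 3 1] merge[of 2 3] merge[of 3 2]
    unfolding crossed_def by (simp flip: One_nat_def) metis
qed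

lemma acyclic_b_chromatic_number_prism: "A\<^sub>b prism = 3"
  unfolding acyclic_b_chromatic_number_def
proof (rule Max_eqI)
  show "finite (irreducible_color_numbers prism)"
    by (rule finite_irreducible_color_numbers) (simp add: pverts_prism)
qed (use irreducible_prism_le_3 three_irreducible_prism in auto)

section \<open>Combining the components\<close>

context cubic_graph
begin

lemma prism_at_iso:
  assumes P: "prism_at x y z x' y' z'" and V: "V = {x, y, z, x', y', z'}"
  shows "digraph_iso (with_proj G) (with_proj prism)"
proof -
  define h where "h = (\<lambda>_. (0::nat, 0::nat))(x := (1, 1), y := (1, 2), z := (1, 3), x' := (2,
    1), y' := (2, 2), z' := (2, 3))"
  have d: "distinct [x, y, z, x', y', z']"
    and n: "nbrs x = {y, z, x'}" "nbrs y = {x, z, y'}" "nbrs z = {x, y, z'}"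
     "nbrs x' = {x, y', z'}" "nbrs y' = {y, x', z'}" "nbrs z' = {z, x', y'}"
    using P by (simp_all add: prism_at_def)
  have h: "h x = (1, 1)" "h y = (1, 2)" "h z = (1, 3)" "h x' = (2, 1)" "h y' = (2, 2)" "h z' = (2, 3)"
    using d by (auto simp: h_def)
  have inj: "inj_on h V"
    unfolding V by (auto simp: inj_on_def h)
  have pv: "pverts prism = {(1, 1), (1, 2), (1, 3), (2, 1), (2, 2), (2, 3)}"
    by (simp add: pverts_prism insert_Times_insert)
  have hV: "h ` V = pverts prism"
    unfolding V pv image_insert image_empty h ..
  note adj = n[THEN adj_nbrs]
  have arc: "adj u w \<longleftrightarrow> (h u, h w) \<in> parcs prism" if "u \<in> V" "w \<in> V" for u w
  proof -
    have "\<forall>u\<in>V. \<forall>w\<in>V. adj u w \<longleftrightarrow> (h u, h w) \<in> parcs prism"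
      unfolding V using d by (simp add: h adj parcs_prism pv) auto
    then show ?thesis
      using that by blast
  qed
  have sub: "parcs prism \<subseteq> pverts prism \<times> pverts prism"
    by (auto simp: cartesian_product_def complete_graph_def)
  \<comment> \<open>Arcs are ordered pairs, so the vertex map induces the arc part of the
    isomorphism.\<close>
  have "map_prod h h ` parcs G = parcs prism"
  proof (intro equalityI subsetI)
    fix e assume "e \<in> map_prod h h ` parcs G"
    then obtain u w where "adj u w" "e = (h u, h w)" by auto
    then show "e \<in> parcs prism"
      using arc[OF adj_in_V[of u w]] by simp
  next
    fix e assume e: "e \<in> parcs prism"
    then have "fst e \<in> h ` V" "snd e \<in> h ` V"
      using subsetD[OF sub e] unfolding hV by auto
    then obtain u w where uw: "u \<in> V" "w \<in> V" "fst e = h u" "snd e = h w"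
      by blast
    then have "e = map_prod h h (u, w)"
      by (simp add: prod_eq_iff)
    moreover have "adj u w"
      using arc[OF uw(1,2)] e uw(3,4) by (metis prod.collapse)
    ultimately show "e \<in> map_prod h h ` parcs G"
      by blast
  qed
  moreover have "inj_on (map_prod h h) (parcs G)"
    by (rule inj_on_subset[OF map_prod_inj_on[OF inj inj]]) (auto simp: adj_in_V)
  ultimately show ?thesis
    using inj hV wf_digraph_axioms unfolding digraph_iso_def
    by (intro exI[of _ "\<lparr>iso_verts = h, iso_arcs = map_prod h h, iso_head = snd, iso_tail =
      fst\<rparr>"])
      (auto simp: pre_digraph.digraph_isomorphism_def app_iso_def with_proj_def)
qed


text \<open>Without an irreducible coloring in four colors every triangle lies in a prism, and all
  vertices of a prism lie in triangles. So the set \<open>T\<close> of vertices in triangles is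
  closed under adjacency, and the triangle-free rest can be treated on its own.\<close>

theorem irreducible_unless_prism:
  assumes "V \<noteq> {}" "\<not> digraph_iso (with_proj G) (with_proj prism)"
  shows "4 \<in> irreducible_color_numbers G"
proof (rule ccontr)
  assume no: "4 \<notin> irreducible_color_numbers G"
  define T where "T = {x \<in> V. \<exists>y z. adj x y \<and> adj y z \<and> adj x z}"
  have prism: "\<exists>y z x' y' z'. prism_at x y z x' y' z'" if "x \<in> T" for x
    using that irreducible_triangle no unfolding T_def by blast
  have T_I: "a \<in> T" if "adj a b" "adj b c" "adj a c" for a b c
    using that adj_in_V(1) unfolding T_def by blast
  have T: "w \<in> T" if "x \<in> T" "adj x w" for x w
  proof -
    obtain y z x' y' z' where P: "prism_at x y z x' y' z'"
      using prism[OF \<open>x \<in> T\<close>] by blast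
    then have n: "nbrs x = {y, z, x'}" "nbrs y = {x, z, y'}" "nbrs z = {x, y, z'}"
       "nbrs x' = {x, y', z'}" "nbrs y' = {y, x', z'}"
      by (simp_all add: prism_at_def)
    note adj = n[THEN adj_nbrs]
    have "w = y \<or> w = z \<or> w = x'"
      using \<open>adj x w\<close> adj(1) by simp
    moreover have "y \<in> T" "z \<in> T" "x' \<in> T"
      using T_I[of y x z] T_I[of z x y] T_I[of x' y' z'] adj by simp_all
    ultimately show ?thesis
      by blast
  qed
  have "V \<subseteq> T"
  proof
    fix v assume "v \<in> V"
    show "v \<in> T"
    proof (rule ccontr)
      assume "v \<notin> T"
      have closed: "w \<in> V - T" if "u \<in> V - T" "adj u w" for u w
        using that T adj_sym adj_in_V by blast
      have no3: False if "x \<in> V - T" "adj x y" "adj y z" "adj z x" for x y z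
        using T_I[OF that(2,3) adj_sym[OF that(4)]] that(1) by blast
      have no4: "x = z \<or> y = w" if "x \<in> V - T" "adj x y" "adj y z" "adj z w" "adj w x" for x y z w
      proof (rule ccontr)
        assume "\<not> ?thesis"
        moreover have "y \<in> V - T" "z \<in> V - T" "w \<in> V - T"
          using closed that by blast+
        ultimately have "4 \<in> irreducible_color_numbers G"
          using that(1) by (intro irreducible_quadrilateral[OF that(2-5)]) (auto intro: no3)
        with no show False ..
      qed
      have "4 \<in> irreducible_color_numbers G"
      proof (rule irreducible_girth_5)
        show "v \<in> V - T" "V - T \<subseteq> V"
          using \<open>v \<in> V\<close> \<open>v \<notin> T\<close> by auto
      qed (use closed no3 no4 in blast)+
      with no show False ..
    qed
  qed
  obtain x where "x \<in> V" using assms(1) by blast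
  then obtain y z x' y' z' where P: "prism_at x y z x' y' z'"
    using prism \<open>V \<subseteq> T\<close> by blast
  let ?P = "{x, y, z, x', y', z'}"
  \<comment> \<open>A prism contains all neighbors of its vertices, so a vertex outside it belongs
    to a disjoint second prism.\<close>
  have closed: "w \<in> ?P" if "u \<in> ?P" "w \<in> nbrs u" for u w
    using that P unfolding prism_at_def by (elim insertE emptyE) auto
  have "?P \<subseteq> V"
    using P nbrs_subset[of x] nbrs_subset[of y] nbrs_subset[of x'] unfolding prism_at_def by auto
  moreover have "V \<noteq> ?P"
    using prism_at_iso[OF P] assms(2) by blast
  ultimately obtain p where p: "p \<in> V" "p \<notin> ?P" by blast
  then obtain q r p' q' r' where Q: "prism_at p q r p' q' r'"
    using prism \<open>V \<subseteq> T\<close> by blast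
  have outside: "u \<notin> ?P" if "w \<notin> ?P" "w \<in> nbrs u" for u w
    using that closed by blast
  have "p \<in> nbrs q" "p \<in> nbrs r" "p \<in> nbrs p'" "q \<in> nbrs q'" "r \<in> nbrs r'"
    using Q by (simp_all add: prism_at_def)
  then have "?P \<inter> {p, q, r, p', q', r'} = {}"
    using p(2) outside by blast
  then show False
    using irreducible_two_prisms[OF P Q] no by blast
qed

end

theorem theorem3p3:
  shows "(\<forall>G :: 'a pair_pre_digraph.
            pair_graph G \<and> pverts G \<noteq> {} \<and> cubic G \<and>
            \<not> digraph_iso (with_proj G) (with_proj prism) \<longrightarrow> A\<^sub>b G \<ge> 4) \<and>
         A\<^sub>b prism = 3"
proof (intro conjI allI impI)
  fix G :: "'a pair_pre_digraph"
  assume G: "pair_graph G \<and> pverts G \<noteq> {} \<and> cubic G \<and> \<not> digraph_iso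
    (with_proj G) (with_proj prism)"
  then interpret cubic_graph G
    by (simp add: cubic_graph_def cubic_graph_axioms_def)
  have "4 \<in> irreducible_color_numbers G"
    using irreducible_unless_prism G by blast
  then show "A\<^sub>b G \<ge> 4"
    unfolding acyclic_b_chromatic_number_def
    by (intro Max_ge finite_irreducible_color_numbers pair_finite_verts)
qed (rule acyclic_b_chromatic_number_prism)

end
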